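(* For all $n$ and all integers $q\ge 1$, $\mathrm{H}_q(\mathrm{PartialOr}_n) = \Theta(n/q + \sqrt{n})$.
   Context: $\mathrm{PartialOr}_n$ is the partial Boolean function on $\{0,1\}^n$ defined on inputs of Hamming weight at most $1$, with value equal to the OR of the input bits. A quantum decision tree making $t$ queries is specified by unitaries $U_0,\dots,U_t$ and outputs the result of measuring $U_tO_xU_{t-1}O_x\cdots O_xU_0|0\rangle|0\rangle|0\rangle$ in the computational basis, where $O_x|i\rangle|b\rangle|w\rangle=|i\rangle|b\oplus x_i\rangle|w\rangle$. A hybrid decision tree $T$ is a rooted tree where each internal node $v$ carries a quantum decision tree $\mathcal{A}_v$, whose possible outputs are in one-to-one correspondence with the children of $v$; leaves are labeled with output values. On input $x$, starting from the root one runs $\mathcal{A}_v(x)$, moves to the child corresponding to its output, and repeats until reaching a leaf, whose label is the output. The cost of a root-to-leaf path is the sum of the query counts of the $\mathcal{A}_v$ on it, and the cost of $T$ is the maximum cost of a root-to-leaf path. $T$ is $q$-limited if every $\mathcal{A}_v$ makes at most $q$ queries. $T$ computes a partial function $f:D\to\{0,1\}$ if for every $x\in D$ it outputs $f(x)$ with probability at least $2/3$. The hybrid query complexity $\mathrm{H}_q(f)$ is the minimal cost of a $q$-limited hybrid decision tree computing $f$. *)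

theory Defs
  imports Jordan_Normal_Form.Schur_Decomposition
begin

section \<open>Quantum decision trees\<close>

text \<open>
  The state space of a quantum decision tree on \<open>n\<close>-bit inputs has the basis vectors
  \<open>|i\<rangle>|b\<rangle>|w\<rangle>\<close> with \<open>i < n\<close>, \<open>b\<close> a bit and \<open>w < W\<close>, where the workspace dimension \<open>W\<close>
  is an arbitrary positive number chosen by the algorithm.  These triples are enumerated
  lexicographically by the numbers below \<open>n * 2 * W\<close>.
\<close>

definition basis_index :: "nat \<Rightarrow> nat \<Rightarrow> bool \<Rightarrow> nat \<Rightarrow> nat" where
  "basis_index W i b w = (2 * i + of_bool b) * W + w"

definition query_reg :: "nat \<Rightarrow> nat \<Rightarrow> nat" where
  "query_reg W k = k div W div 2"

definition target_reg :: "nat \<Rightarrow> nat \<Rightarrow> bool" where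
  "target_reg W k = odd (k div W)"

definition work_reg :: "nat \<Rightarrow> nat \<Rightarrow> nat" where
  "work_reg W k = k mod W"

definition query_mat :: "nat \<Rightarrow> nat \<Rightarrow> bool list \<Rightarrow> complex mat" where
  "query_mat n W x = mat (n * 2 * W) (n * 2 * W) (\<lambda>(r, c). of_bool
     (r = basis_index W (query_reg W c) (target_reg W c \<noteq> x ! query_reg W c) (work_reg W c)))"

definition unitary :: "nat \<Rightarrow> complex mat \<Rightarrow> bool" where
  "unitary d U \<longleftrightarrow>
     U \<in> carrier_mat d d \<and> mat_adjoint U * U = 1\<^sub>m d \<and> U * mat_adjoint U = 1\<^sub>m d"

text \<open>
  The unitary \<open>U\<^sub>0\<close> is stored separately from \<open>[U\<^sub>1, \<dots>, U\<^sub>t]\<close>, so the number \<open>t\<close> of queries is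
  the length of that list; \<open>t = 0\<close> is allowed.
\<close>

datatype qdtree = QDTree (work_dim: nat) (first_unitary: "complex mat")
  (later_unitaries: "complex mat list")

definition queries :: "qdtree \<Rightarrow> nat" where
  "queries A = length (later_unitaries A)"

definition state_dim :: "nat \<Rightarrow> qdtree \<Rightarrow> nat" where
  "state_dim n A = n * 2 * work_dim A"

text \<open>Positivity of the dimension says that the start vector \<open>|0\<rangle>|0\<rangle>|0\<rangle>\<close> exists.\<close>

definition valid_qdtree :: "nat \<Rightarrow> qdtree \<Rightarrow> bool" where
  "valid_qdtree n A \<longleftrightarrow>
     0 < state_dim n A \<and> unitary (state_dim n A) (first_unitary A) \<and>
     (\<forall>U \<in> set (later_unitaries A). unitary (state_dim n A) U)"

definition final_state :: "nat \<Rightarrow> bool list \<Rightarrow> qdtree \<Rightarrow> complex vec" where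
  "final_state n x A =
     foldl (\<lambda>\<psi> U. U *\<^sub>v (query_mat n (work_dim A) x *\<^sub>v \<psi>))
       (first_unitary A *\<^sub>v unit_vec (state_dim n A) (basis_index (work_dim A) 0 False 0))
       (later_unitaries A)"

definition outcome_prob :: "nat \<Rightarrow> bool list \<Rightarrow> qdtree \<Rightarrow> nat \<Rightarrow> real" where
  "outcome_prob n x A k = (cmod (final_state n x A $ k))\<^sup>2"

lemma query_mat_unit_vec:
  assumes "i < n" "w < W"
  shows "query_mat n W x *\<^sub>v unit_vec (n * 2 * W) (basis_index W i b w) =
         unit_vec (n * 2 * W) (basis_index W i (b \<noteq> x ! i) w)"
proof -
  have less: "basis_index W i c w < n * 2 * W" for c
  proof -
    have "basis_index W i c w < (2 * i + of_bool c + 1) * W"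
      using assms(2) by (simp add: basis_index_def algebra_simps)
    also have "\<dots> \<le> n * 2 * W"
      using assms(1) by (intro mult_right_mono) (auto simp: of_bool_def)
    finally show ?thesis .
  qed
  have regs: "query_reg W (basis_index W i b w) = i" "target_reg W (basis_index W i b w) = b"
    "work_reg W (basis_index W i b w) = w"
    using assms(2) by (auto simp: basis_index_def query_reg_def target_reg_def work_reg_def)
  show ?thesis
    using less by (intro eq_vecI) (auto simp: query_mat_def regs scalar_prod_right_unit)
qed

section \<open>Hybrid decision trees\<close>

text \<open>
  The possible outputs of the quantum decision tree at a node are all computational basis
  states; the \<open>k\<close>-th child corresponds to the \<open>k\<close>-th basis state.
\<close>

datatype hybrid_tree = Leaf bool | Node qdtree "hybrid_tree list"

fun valid_hybrid_tree :: "nat \<Rightarrow> hybrid_tree \<Rightarrow> bool" where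
  "valid_hybrid_tree n (Leaf y) \<longleftrightarrow> True"
| "valid_hybrid_tree n (Node A Ts) \<longleftrightarrow>
     valid_qdtree n A \<and> length Ts = state_dim n A \<and> (\<forall>T \<in> set Ts. valid_hybrid_tree n T)"

fun output_prob :: "nat \<Rightarrow> bool list \<Rightarrow> hybrid_tree \<Rightarrow> bool \<Rightarrow> real" where
  "output_prob n x (Leaf z) y = of_bool (z = y)"
| "output_prob n x (Node A Ts) y =
     (\<Sum>k<length Ts. outcome_prob n x A k * map (\<lambda>T. output_prob n x T y) Ts ! k)"

fun path_costs :: "hybrid_tree \<Rightarrow> nat set" where
  "path_costs (Leaf y) = {0}"
| "path_costs (Node A Ts) = (\<lambda>c. queries A + c) ` (\<Union>T \<in> set Ts. path_costs T)"

definition cost :: "hybrid_tree \<Rightarrow> nat" where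
  "cost T = Max (path_costs T)"

fun limited :: "nat \<Rightarrow> hybrid_tree \<Rightarrow> bool" where
  "limited q (Leaf y) \<longleftrightarrow> True"
| "limited q (Node A Ts) \<longleftrightarrow> queries A \<le> q \<and> (\<forall>T \<in> set Ts. limited q T)"

text \<open>
  A partial function on \<open>n\<close>-bit inputs is a map on bit lists whose domain consists of lists
  of length \<open>n\<close>.
\<close>

definition computes :: "nat \<Rightarrow> hybrid_tree \<Rightarrow> (bool list \<rightharpoonup> bool) \<Rightarrow> bool" where
  "computes n T f \<longleftrightarrow> (\<forall>x y. f x = Some y \<longrightarrow> output_prob n x T y \<ge> 2 / 3)"

text \<open>
  The \<open>LEAST\<close> is a genuine minimum when \<open>q \<ge> 1\<close>: reading the input bits one after the other
  is a \<open>1\<close>-limited hybrid decision tree that computes \<open>f\<close>.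
\<close>

definition hybrid_query_complexity :: "nat \<Rightarrow> nat \<Rightarrow> (bool list \<rightharpoonup> bool) \<Rightarrow> nat" where
  "hybrid_query_complexity n q f =
     (LEAST c. \<exists>T. valid_hybrid_tree n T \<and> limited q T \<and> computes n T f \<and> cost T = c)"

definition partial_or :: "nat \<Rightarrow> bool list \<rightharpoonup> bool" where
  "partial_or n x =
     (if length x = n \<and> count_list x True \<le> 1 then Some (\<exists>i<n. x ! i) else None)"

end

theory Submission
  imports Defs "HOL-Analysis.L2_Norm"
begin

text \<open>
  Lower bound: fix a hybrid tree and compare its run on the zero string with its runs on the strings
  \<open>e\<^sub>j\<close> with a single one at \<open>j\<close>.  For a quantum decision tree with \<open>t\<close> queries, the vector of the
  \<open>n\<close> distances between the corresponding final states grows by at most \<open>2\<close> per query in the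
  Euclidean norm, so the squared Hellinger distances of the outcome distributions sum to at most
  \<open>O(t\<^sup>2)\<close> over all \<open>j\<close>.  A chain rule for the Hellinger distance, with expectations taken under
  the zero input only, adds these contributions along the tree.  In an \<open>r\<close>-limited tree
  the sum of \<open>t\<^sup>2\<close> along a path is at most \<open>r\<close> times its cost, while every single \<open>e\<^sub>j\<close> needs a
  constant distance; hence \<open>n = O(r * cost)\<close>.  Taking \<open>r = q\<close> and \<open>r = cost\<close> gives both terms.

  Upper bound: an exact version of Grover's algorithm with \<open>k\<close> queries decides without error
  whether a block of \<open>k\<^sup>2\<close> positions contains the one.  Running it on
  \<open>\<lfloor>n / k\<^sup>2\<rfloor> + 1\<close> blocks in turn costs at most \<open>n / k + k\<close>, and \<open>k\<close> is the minimum of \<open>q\<close> and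
  \<open>\<lceil>sqrt n\<rceil>\<close>.
\<close>

section \<open>Unitary matrices and norms\<close>

lemma mat_adjoint_index:
  fixes A :: "complex mat"
  assumes "i < dim_col A" "j < dim_row A"
  shows "mat_adjoint A $$ (i, j) = cnj (A $$ (j, i))"
  using assms by (simp add: mat_adjoint_def mat_of_rows_def)

lemma mat_adjoint_carrier:
  "(A :: complex mat) \<in> carrier_mat m n \<Longrightarrow> mat_adjoint A \<in> carrier_mat n m"
  by (auto simp: mat_adjoint_def)

lemma mat_adjoint_mult:
  fixes A B :: "complex mat"
  assumes "A \<in> carrier_mat l m" "B \<in> carrier_mat m n"
  shows "mat_adjoint (A * B) = mat_adjoint B * mat_adjoint A"
proof (rule eq_matI)
  note dims = mat_adjoint_carrier[OF assms(1)] mat_adjoint_carrier[OF assms(2)]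
    mat_adjoint_carrier[OF mult_carrier_mat[OF assms]]
  fix i j assume "i < dim_row (mat_adjoint B * mat_adjoint A)"
    "j < dim_col (mat_adjoint B * mat_adjoint A)"
  then have "i < n" "j < l"
    using dims by auto
  then show "mat_adjoint (A * B) $$ (i, j) = (mat_adjoint B * mat_adjoint A) $$ (i, j)"
    using assms dims by (auto simp: mat_adjoint_index scalar_prod_def mult.commute)
qed (use mat_adjoint_carrier[OF assms(1)] mat_adjoint_carrier[OF assms(2)]
    mat_adjoint_carrier[OF mult_carrier_mat[OF assms]] in auto)

lemma unitary_mult:
  assumes "unitary d A" "unitary d B"
  shows "unitary d (A * B)"
proof -
  have c: "A \<in> carrier_mat d d" "B \<in> carrier_mat d d"
    "mat_adjoint A \<in> carrier_mat d d" "mat_adjoint B \<in> carrier_mat d d"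
    using assms by (auto simp: unitary_def mat_adjoint_carrier)
  have "mat_adjoint (A * B) * (A * B) = mat_adjoint B * ((mat_adjoint A * A) * B)"
    using c by (simp add: mat_adjoint_mult[OF c(1,2)] assoc_mult_mat[of _ d d _ d _ d])
  moreover have "(A * B) * mat_adjoint (A * B) = A * ((B * mat_adjoint B) * mat_adjoint A)"
    using c by (simp add: mat_adjoint_mult[OF c(1,2)] assoc_mult_mat[of _ d d _ d _ d])
  ultimately show ?thesis
    using assms c by (simp add: unitary_def del: assoc_mult_mat)
qed

definition vnorm :: "complex vec \<Rightarrow> real" where
  "vnorm v = L2_set (\<lambda>i. cmod (v $ i)) {..<dim_vec v}"

lemma vnorm_nonneg [simp]: "0 \<le> vnorm v"
  by (simp add: vnorm_def)

lemma vnorm_square: "(vnorm v)\<^sup>2 = (\<Sum>i<dim_vec v. (cmod (v $ i))\<^sup>2)"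
  by (simp add: vnorm_def L2_set_def sum_nonneg)

lemma vnorm_unit_vec: "i < d \<Longrightarrow> vnorm (unit_vec d i) = 1"
proof -
  assume "i < d"
  have "(vnorm (unit_vec d i))\<^sup>2 = (\<Sum>j<d. if j = i then 1 else 0)"
    unfolding vnorm_square by (intro sum.cong) (auto simp: unit_vec_def)
  then have "(vnorm (unit_vec d i))\<^sup>2 = 1\<^sup>2"
    using \<open>i < d\<close> by simp
  then show ?thesis
    using power2_eq_imp_eq by fastforce
qed

lemma vnorm_triangle:
  assumes "v \<in> carrier_vec d" "w \<in> carrier_vec d"
  shows "vnorm (v + w) \<le> vnorm v + vnorm w"
proof -
  have "vnorm (v + w) \<le> L2_set (\<lambda>i. cmod (v $ i) + cmod (w $ i)) {..<d}"
    unfolding vnorm_def using assms by (auto intro!: L2_set_mono norm_triangle_ineq)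
  also have "\<dots> \<le> vnorm v + vnorm w"
    unfolding vnorm_def using assms L2_set_triangle_ineq by auto
  finally show ?thesis .
qed

text \<open>Expanding the squared norm gives a sum over one row index and two column indices.
  Summing over rows first leaves inner products of columns of \<open>U\<close>, which are Kronecker
  deltas.\<close>

lemma unitary_vnorm:
  assumes U: "unitary d U" and v: "v \<in> carrier_vec d"
  shows "vnorm (U *\<^sub>v v) = vnorm v"
proof -
  have c: "U \<in> carrier_mat d d" "mat_adjoint U \<in> carrier_mat d d"
    using U by (auto simp: unitary_def mat_adjoint_carrier)
  have col: "(\<Sum>i<d. cnj (U $$ (i, b)) * U $$ (i, a)) = of_bool (a = b)" if "a < d" "b < d" for a b
  proof -
    have "(mat_adjoint U * U) $$ (b, a) = (\<Sum>i<d. cnj (U $$ (i, b)) * U $$ (i, a))"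
      using that c by (auto simp: scalar_prod_def mat_adjoint_index atLeast0LessThan intro!: sum.cong)
    then show ?thesis
      using U that by (auto simp: unitary_def)
  qed
  have "complex_of_real ((vnorm (U *\<^sub>v v))\<^sup>2) =
      (\<Sum>i<d. (U *\<^sub>v v) $ i * cnj ((U *\<^sub>v v) $ i))"
    using c by (simp add: vnorm_square complex_norm_square del: of_real_power)
  also have "\<dots> = (\<Sum>i<d. (\<Sum>a<d. U $$ (i, a) * v $ a) * (\<Sum>b<d. cnj (U $$ (i, b)) * cnj (v $ b)))"
    using c v by (intro sum.cong) (auto simp: scalar_prod_def atLeast0LessThan cnj_sum)
  also have "\<dots> = (\<Sum>i<d. \<Sum>a<d. \<Sum>b<d. v $ a * cnj (v $ b) * (cnj (U $$ (i, b)) * U $$ (i, a)))"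
    by (simp add: sum_product mult_ac)
  also have "\<dots> = (\<Sum>a<d. \<Sum>b<d. \<Sum>i<d. v $ a * cnj (v $ b) * (cnj (U $$ (i, b)) * U $$ (i, a)))"
    by (subst sum.swap) (intro sum.cong refl sum.swap)
  also have "\<dots> = (\<Sum>a<d. \<Sum>b<d. v $ a * cnj (v $ b) * of_bool (a = b))"
    by (intro sum.cong refl) (simp add: sum_distrib_left[symmetric] col del: of_bool_eq)
  also have "\<dots> = (\<Sum>a<d. v $ a * cnj (v $ a))"
    by (intro sum.cong refl) (auto simp: of_bool_def if_distrib cong: if_cong)
  also have "\<dots> = complex_of_real ((vnorm v)\<^sup>2)"
    using v by (simp add: vnorm_square complex_norm_square del: of_real_power)
  finally have "(vnorm (U *\<^sub>v v))\<^sup>2 = (vnorm v)\<^sup>2"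
    using of_real_eq_iff by blast
  then show ?thesis
    by simp
qed

section \<open>Queries\<close>

text \<open>The permutation of basis indices behind \<open>query_mat\<close>: column
  \<open>c\<close> has its one in row \<open>flip W x c\<close>.\<close>

definition flip :: "nat \<Rightarrow> bool list \<Rightarrow> nat \<Rightarrow> nat" where
  "flip W x c =
     basis_index W (query_reg W c) (target_reg W c \<noteq> x ! query_reg W c) (work_reg W c)"

lemma basis_index_less:
  assumes "i < n" "w < W"
  shows "basis_index W i b w < n * 2 * W"
proof -
  have "basis_index W i b w < (2 * i + of_bool b + 1) * W"
    using assms(2) by (simp add: basis_index_def algebra_simps)
  also have "\<dots> \<le> n * 2 * W"
    using assms(1) by (intro mult_right_mono) (auto simp: of_bool_def)
  finally show ?thesis .
qed

lemma registers_basis_index: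
  assumes "w < W"
  shows "query_reg W (basis_index W i b w) = i" "target_reg W (basis_index W i b w) = b"
    "work_reg W (basis_index W i b w) = w"
  using assms by (auto simp: basis_index_def query_reg_def target_reg_def work_reg_def)

lemma basis_index_registers: "basis_index W (query_reg W c) (target_reg W c) (work_reg W c) = c"
proof -
  have "2 * query_reg W c + of_bool (target_reg W c) = c div W"
    using mult_div_mod_eq[of 2 "c div W"] by (simp add: query_reg_def target_reg_def mod_2_eq_odd)
  then show ?thesis
    by (simp add: basis_index_def work_reg_def)
qed

lemma query_reg_less: "c < n * 2 * W \<Longrightarrow> query_reg W c < n"
  by (simp add: query_reg_def less_mult_imp_div_less)

lemma work_reg_less: "c < n * 2 * W \<Longrightarrow> work_reg W c < W"
  by (cases W) (auto simp: work_reg_def)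

lemma flip_less: "c < n * 2 * W \<Longrightarrow> flip W x c < n * 2 * W"
  by (simp add: flip_def basis_index_less query_reg_less work_reg_less)

lemma flip_flip:
  assumes "c < n * 2 * W"
  shows "flip W x (flip W x c) = c"
proof -
  have "((target_reg W c \<noteq> b) \<noteq> b) = target_reg W c" for b
    by auto
  then show ?thesis
    using work_reg_less[OF assms]
    by (simp only: flip_def registers_basis_index basis_index_registers)
qed

lemma query_reg_flip: "c < n * 2 * W \<Longrightarrow> query_reg W (flip W x c) = query_reg W c"
  by (simp add: flip_def registers_basis_index work_reg_less)

lemma flip_id: "c < n * 2 * W \<Longrightarrow> \<not> x ! query_reg W c \<Longrightarrow> flip W x c = c"
  by (simp add: flip_def basis_index_registers)

lemma bij_flip: "bij_betw (flip W x) {..<n * 2 * W} {..<n * 2 * W}"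
  by (rule bij_betw_byWitness[where f' = "flip W x"]) (auto simp: flip_flip flip_less)

lemma query_mat_carrier: "query_mat n W x \<in> carrier_mat (n * 2 * W) (n * 2 * W)"
  by (simp add: query_mat_def)

text \<open>Row \<open>r\<close> picks out the preimage of \<open>r\<close> under
  \<open>flip\<close>; since \<open>flip\<close> is an involution, this is \<open>flip W x r\<close>
  again.\<close>

lemma query_mat_apply:
  assumes "v \<in> carrier_vec (n * 2 * W)" "r < n * 2 * W"
  shows "(query_mat n W x *\<^sub>v v) $ r = v $ flip W x r"
proof -
  have "(query_mat n W x *\<^sub>v v) $ r = (\<Sum>c<n * 2 * W. of_bool (r = flip W x c) * v $ c)"
    using assms by (simp add: query_mat_def scalar_prod_def flip_def atLeast0LessThan)
  also have "\<dots> = (\<Sum>c<n * 2 * W. if c = flip W x r then v $ c else 0)"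
    using assms(2) by (intro sum.cong) (auto simp: flip_flip)
  also have "\<dots> = v $ flip W x r"
    using flip_less[OF assms(2)] by simp
  finally show ?thesis .
qed

lemma query_mat_vnorm:
  assumes "v \<in> carrier_vec (n * 2 * W)"
  shows "vnorm (query_mat n W x *\<^sub>v v) = vnorm v"
proof -
  have "(vnorm (query_mat n W x *\<^sub>v v))\<^sup>2 = (\<Sum>r<n * 2 * W. (cmod (v $ flip W x r))\<^sup>2)"
    unfolding vnorm_square using query_mat_carrier[of n W x]
    by (intro sum.cong) (auto simp: query_mat_apply[OF assms] simp del: index_mult_mat_vec)
  also have "\<dots> = (\<Sum>r<n * 2 * W. (cmod (v $ r))\<^sup>2)"
    by (rule sum.reindex_bij_betw[OF bij_flip])
  also have "\<dots> = (vnorm v)\<^sup>2"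
    using assms by (simp add: vnorm_square)
  finally show ?thesis
    by simp
qed

lemma minus_vec_split: 
  fixes u v w :: "complex vec"
  assumes "u \<in> carrier_vec d" "v \<in> carrier_vec d" "w \<in> carrier_vec d"
  shows "u - w = (u - v) + (v - w)"
  using assms by (intro eq_vecI) auto

section \<open>Runs of a quantum decision tree on the zero string and on strings of weight
  one\<close>

abbreviation step :: "nat \<Rightarrow> nat \<Rightarrow> bool list \<Rightarrow> complex vec \<Rightarrow> complex mat \<Rightarrow> complex vec" where
  "step n W x \<psi> U \<equiv> U *\<^sub>v (query_mat n W x *\<^sub>v \<psi>)"

lemma step_carrier:
  assumes "unitary (n * 2 * W) U" "\<psi> \<in> carrier_vec (n * 2 * W)"
  shows "step n W x \<psi> U \<in> carrier_vec (n * 2 * W)"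
  using assms query_mat_carrier[of n W x] by (auto simp: unitary_def)

lemma step_vnorm:
  assumes "unitary (n * 2 * W) U" "\<psi> \<in> carrier_vec (n * 2 * W)"
  shows "vnorm (step n W x \<psi> U) = vnorm \<psi>"
  using assms query_mat_carrier[of n W x]
  by (subst unitary_vnorm[OF assms(1)]) (auto simp: query_mat_vnorm)

lemma run_carrier_vnorm:
  assumes "\<forall>U \<in> set Us. unitary (n * 2 * W) U" "\<psi> \<in> carrier_vec (n * 2 * W)"
  shows "foldl (step n W x) \<psi> Us \<in> carrier_vec (n * 2 * W) \<and>
    vnorm (foldl (step n W x) \<psi> Us) = vnorm \<psi>"
  using assms
proof (induction Us arbitrary: \<psi>)
  case (Cons U Us)
  have U: "unitary (n * 2 * W) U"
    using Cons.prems by simp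
  show ?case
    using Cons.IH[OF _ step_carrier[OF U Cons.prems(2)]] Cons.prems step_vnorm[OF U Cons.prems(2)]
    by simp
qed simp

abbreviation zeros :: "nat \<Rightarrow> bool list" where
  "zeros n \<equiv> replicate n False"

definition single :: "nat \<Rightarrow> nat \<Rightarrow> bool list" where
  "single n j = (zeros n)[j := True]"

lemma single_nth: "i < n \<Longrightarrow> single n j ! i \<longleftrightarrow> i = j"
  by (cases "i = j") (auto simp: single_def)

lemma query_mat_unmarked:
  assumes "v \<in> carrier_vec (n * 2 * W)" "\<And>i. i < n \<Longrightarrow> \<not> x ! i"
  shows "query_mat n W x *\<^sub>v v = v"
proof (rule eq_vecI)
  fix r assume "r < dim_vec v"
  then have r: "r < n * 2 * W"
    using assms(1) by simp
  show "(query_mat n W x *\<^sub>v v) $ r = v $ r"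
    using query_mat_apply[OF assms(1) r] flip_id[OF r] query_reg_less[OF r] assms(2) by simp
qed (use assms query_mat_carrier[of n W x] in auto)

text \<open>The query for \<open>j\<close> moves only amplitudes whose query register is
  \<open>j\<close>, so the sum over \<open>j\<close> charges each amplitude to a single
  \<open>j\<close>. The 4 arises from \<open>|a - b|^2 <= 2 |a|^2 + 2 |b|^2\<close>, where
  \<open>a\<close> and \<open>b\<close> run over the same amplitudes.\<close>

lemma query_mat_deviation:
  assumes v: "v \<in> carrier_vec (n * 2 * W)"
  shows "(\<Sum>j<n. (vnorm (v - query_mat n W (single n j) *\<^sub>v v))\<^sup>2) \<le> 4 * (vnorm v)\<^sup>2"
proof -
  let ?d = "n * 2 * W"
  have one: "(vnorm (v - query_mat n W (single n j) *\<^sub>v v))\<^sup>2 \<le>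
      (\<Sum>r<?d. of_bool (query_reg W r = j) * (4 * (cmod (v $ r))\<^sup>2))" for j
  proof -
    let ?f = "flip W (single n j)"
    let ?g = "\<lambda>r. of_bool (query_reg W r = j) * (2 * (cmod (v $ r))\<^sup>2)"
    have "(cmod (v $ r - v $ ?f r))\<^sup>2 \<le> ?g r + ?g (?f r)" if r: "r < ?d" for r
    proof (cases "query_reg W r = j")
      case True
      have "(cmod (v $ r - v $ ?f r))\<^sup>2 \<le> (cmod (v $ r) + cmod (v $ ?f r))\<^sup>2"
        by (intro power_mono norm_triangle_ineq4) auto
      also have "\<dots> \<le> 2 * (cmod (v $ r))\<^sup>2 + 2 * (cmod (v $ ?f r))\<^sup>2"
        using sum_squares_bound[of "cmod (v $ r)" "cmod (v $ ?f r)"]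
        by (simp add: power2_sum)
      finally show ?thesis
        using True r by (simp add: query_reg_flip)
    next
      case False
      then show ?thesis
        using r by (simp add: flip_id single_nth query_reg_less)
    qed
    then have "(\<Sum>r<?d. (cmod (v $ r - v $ ?f r))\<^sup>2) \<le> (\<Sum>r<?d. ?g r + ?g (?f r))"
      by (intro sum_mono) simp
    also have "\<dots> = (\<Sum>r<?d. ?g r) + (\<Sum>r<?d. ?g r)"
      using sum.reindex_bij_betw[OF bij_flip, of ?g W "single n j" n] by (simp add: sum.distrib)
    also have "\<dots> = (\<Sum>r<?d. of_bool (query_reg W r = j) * (4 * (cmod (v $ r))\<^sup>2))"
      by (simp flip: sum.distrib)
    finally show ?thesis
      using v query_mat_carrier[of n W "single n j"]
      by (simp add: vnorm_square query_mat_apply[OF v] del: index_mult_mat_vec)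
  qed
  have "(\<Sum>j<n. (vnorm (v - query_mat n W (single n j) *\<^sub>v v))\<^sup>2) \<le>
      (\<Sum>j<n. \<Sum>r<?d. of_bool (query_reg W r = j) * (4 * (cmod (v $ r))\<^sup>2))"
    by (intro sum_mono one)
  also have "\<dots> = (\<Sum>r<?d. (\<Sum>j<n. of_bool (query_reg W r = j)) * (4 * (cmod (v $ r))\<^sup>2))"
    by (subst sum.swap) (simp add: sum_distrib_right)
  also have "\<dots> = (\<Sum>r<?d. 4 * (cmod (v $ r))\<^sup>2)"
  proof (intro sum.cong refl)
    fix r assume "r \<in> {..<?d}"
    then have "(\<Sum>j<n. of_bool (query_reg W r = j) :: real) = 1"
      using query_reg_less[of r n W] by (simp add: of_bool_def)
    then show "(\<Sum>j<n. of_bool (query_reg W r = j)) * (4 * (cmod (v $ r))\<^sup>2) = 4 * (cmod (v $ r))\<^sup>2"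
      by simp
  qed
  also have "\<dots> = 4 * (vnorm v)\<^sup>2"
    using v by (simp add: vnorm_square sum_distrib_left)
  finally show ?thesis .
qed

text \<open>Hybrid argument: Minkowski's inequality over \<open>j\<close> adds up the errors of the
  individual queries. The start states \<open>\<phi> j\<close> are arbitrary because after the first
  query the runs have already diverged.\<close>

lemma run_deviation:
  assumes "\<forall>U \<in> set Us. unitary (n * 2 * W) U" "\<psi> \<in> carrier_vec (n * 2 * W)" "vnorm \<psi> = 1"
    and "\<And>j. \<phi> j \<in> carrier_vec (n * 2 * W)"
  shows "L2_set (\<lambda>j. vnorm (foldl (step n W (zeros n)) \<psi> Us -
      foldl (step n W (single n j)) (\<phi> j) Us)) {..<n} \<le>
    L2_set (\<lambda>j. vnorm (\<psi> - \<phi> j)) {..<n} + 2 * length Us"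
  using assms
proof (induction Us arbitrary: \<psi> \<phi>)
  case (Cons U Us)
  let ?Q = "\<lambda>j. query_mat n W (single n j)"
  let ?\<psi> = "step n W (zeros n) \<psi> U" and ?\<phi> = "\<lambda>j. step n W (single n j) (\<phi> j) U"
  have U: "unitary (n * 2 * W) U"
    using Cons.prems by simp
  note Qc = query_mat_carrier[of n W "single n _"]
  have bound: "vnorm (?\<psi> - ?\<phi> j) \<le> vnorm (\<psi> - ?Q j *\<^sub>v \<psi>) + vnorm (\<psi> - \<phi> j)" for j
  proof -
    have c: "?Q j *\<^sub>v \<psi> \<in> carrier_vec (n * 2 * W)" "?Q j *\<^sub>v \<phi> j \<in> carrier_vec (n * 2 * W)"
      using mult_mat_vec_carrier[OF Qc] Cons.prems by auto
    have "?\<psi> - ?\<phi> j = U *\<^sub>v (\<psi> - ?Q j *\<^sub>v \<phi> j)"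
      using U query_mat_unmarked[OF Cons.prems(2), of "zeros n"]
        mult_minus_distrib_mat_vec[OF _ Cons.prems(2) c(2), of U "n * 2 * W"]
      by (simp add: unitary_def)
    then have "vnorm (?\<psi> - ?\<phi> j) = vnorm (\<psi> - ?Q j *\<^sub>v \<phi> j)"
      using unitary_vnorm[OF U] c Cons.prems by auto
    \<comment> \<open>The first summand is the error made by this query; the second carries the old
      error through an isometry.\<close>
    also have "\<psi> - ?Q j *\<^sub>v \<phi> j = (\<psi> - ?Q j *\<^sub>v \<psi>) + ?Q j *\<^sub>v (\<psi> - \<phi> j)"
      using minus_vec_split[OF Cons.prems(2) c] Cons.prems
      by (simp add: mult_minus_distrib_mat_vec[OF Qc])
    also have "vnorm \<dots> \<le> vnorm (\<psi> - ?Q j *\<^sub>v \<psi>) + vnorm (?Q j *\<^sub>v (\<psi> - \<phi> j))"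
      using Qc[of j] c Cons.prems by (intro vnorm_triangle[of _ "n * 2 * W"]) auto
    also have "vnorm (?Q j *\<^sub>v (\<psi> - \<phi> j)) = vnorm (\<psi> - \<phi> j)"
      using Cons.prems by (intro query_mat_vnorm) auto
    finally show ?thesis .
  qed
  have "L2_set (\<lambda>j. vnorm (\<psi> - ?Q j *\<^sub>v \<psi>)) {..<n} \<le> 2"
    unfolding L2_set_def using query_mat_deviation[OF Cons.prems(2)] Cons.prems(3)
    by (intro real_le_lsqrt) auto
  moreover have "L2_set (\<lambda>j. vnorm (?\<psi> - ?\<phi> j)) {..<n} \<le>
      L2_set (\<lambda>j. vnorm (\<psi> - ?Q j *\<^sub>v \<psi>) + vnorm (\<psi> - \<phi> j)) {..<n}"
    by (intro L2_set_mono bound) auto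
  moreover have "\<dots> \<le> L2_set (\<lambda>j. vnorm (\<psi> - ?Q j *\<^sub>v \<psi>)) {..<n} +
      L2_set (\<lambda>j. vnorm (\<psi> - \<phi> j)) {..<n}"
    by (rule L2_set_triangle_ineq)
  ultimately have "L2_set (\<lambda>j. vnorm (?\<psi> - ?\<phi> j)) {..<n} \<le>
      L2_set (\<lambda>j. vnorm (\<psi> - \<phi> j)) {..<n} + 2"
    by linarith
  moreover have "L2_set (\<lambda>j. vnorm (foldl (step n W (zeros n)) ?\<psi> Us -
      foldl (step n W (single n j)) (?\<phi> j) Us)) {..<n} \<le>
    L2_set (\<lambda>j. vnorm (?\<psi> - ?\<phi> j)) {..<n} + 2 * length Us"
    using Cons.prems by (intro Cons.IH step_carrier[OF U]) (auto simp: step_vnorm[OF U])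
  ultimately show ?case
    by simp
qed simp

lemma start_state:
  assumes "valid_qdtree n A"
  defines "\<psi> \<equiv> first_unitary A *\<^sub>v unit_vec (state_dim n A) (basis_index (work_dim A) 0 False 0)"
  shows "\<psi> \<in> carrier_vec (n * 2 * work_dim A)" "vnorm \<psi> = 1"
proof -
  have U: "unitary (n * 2 * work_dim A) (first_unitary A)" and d: "0 < state_dim n A"
    using assms(1) by (auto simp: valid_qdtree_def state_dim_def)
  show "\<psi> \<in> carrier_vec (n * 2 * work_dim A)"
    using U by (auto simp: \<psi>_def unitary_def state_dim_def)
  have "basis_index (work_dim A) 0 False 0 < state_dim n A"
    using d by (simp add: basis_index_def)
  then show "vnorm \<psi> = 1"
    unfolding \<psi>_def using unitary_vnorm[OF U] by (simp add: state_dim_def vnorm_unit_vec)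
qed

section \<open>Outcome distributions and their distance at a single node\<close>

lemma final_state_carrier_vnorm:
  assumes "valid_qdtree n A"
  shows "final_state n x A \<in> carrier_vec (state_dim n A)" "vnorm (final_state n x A) = 1"
  using run_carrier_vnorm[OF _ start_state(1)[OF assms], of "later_unitaries A" x]
    start_state(2)[OF assms] assms
  by (auto simp: final_state_def valid_qdtree_def state_dim_def)

lemma outcome_prob_nonneg: "0 \<le> outcome_prob n x A k"
  by (simp add: outcome_prob_def)

lemma outcome_prob_sum:
  assumes "valid_qdtree n A"
  shows "(\<Sum>k<state_dim n A. outcome_prob n x A k) = 1"
  using final_state_carrier_vnorm[OF assms, of x] vnorm_square[of "final_state n x A"]
  by (simp add: outcome_prob_def)

text \<open>The squared Hellinger distance of the two outcome distributions: one minus their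
  Bhattacharyya coefficient.\<close>

definition node_loss :: "nat \<Rightarrow> bool list \<Rightarrow> bool list \<Rightarrow> qdtree \<Rightarrow> real" where
  "node_loss n x y A =
     1 - (\<Sum>k<state_dim n A. sqrt (outcome_prob n x A k * outcome_prob n y A k))"

lemma node_loss_eq:
  assumes "valid_qdtree n A"
  shows "2 * node_loss n x y A =
    (\<Sum>k<state_dim n A. (sqrt (outcome_prob n x A k) - sqrt (outcome_prob n y A k))\<^sup>2)"
proof -
  have "(\<Sum>k<state_dim n A. (sqrt (outcome_prob n x A k) - sqrt (outcome_prob n y A k))\<^sup>2) =
    (\<Sum>k<state_dim n A. outcome_prob n x A k + outcome_prob n y A k -
      2 * sqrt (outcome_prob n x A k * outcome_prob n y A k))"
    by (intro sum.cong refl) (simp add: power2_diff outcome_prob_nonneg real_sqrt_mult)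
  also have "\<dots> = 2 * node_loss n x y A"
    by (simp add: sum.distrib sum_subtractf outcome_prob_sum[OF assms] node_loss_def
        flip: sum_distrib_left)
  finally show ?thesis ..
qed

lemma node_loss_nonneg: "valid_qdtree n A \<Longrightarrow> 0 \<le> node_loss n x y A"
  using node_loss_eq[of n A x y]
    sum_nonneg[of "{..<state_dim n A}" "\<lambda>k. (sqrt (outcome_prob n x A k) - sqrt (outcome_prob n y A k))\<^sup>2"]
  by simp

text \<open>Replacing amplitudes by their moduli only shrinks distances, by the reverse triangle
  inequality.\<close>

lemma node_loss_le:
  assumes "valid_qdtree n A"
  shows "2 * node_loss n x y A \<le> (vnorm (final_state n x A - final_state n y A))\<^sup>2"
proof -
  let ?\<psi> = "final_state n x A" and ?\<phi> = "final_state n y A"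
  have "(cmod (?\<psi> $ k) - cmod (?\<phi> $ k))\<^sup>2 \<le> (cmod (?\<psi> $ k - ?\<phi> $ k))\<^sup>2" for k
    by (metis abs_le_square_iff abs_norm_cancel norm_triangle_ineq3)
  then have "(\<Sum>k<state_dim n A. (cmod (?\<psi> $ k) - cmod (?\<phi> $ k))\<^sup>2) \<le>
      (\<Sum>k<state_dim n A. (cmod (?\<psi> $ k - ?\<phi> $ k))\<^sup>2)"
    by (intro sum_mono) simp
  also have "\<dots> = (vnorm (?\<psi> - ?\<phi>))\<^sup>2"
    using final_state_carrier_vnorm(1)[OF assms, of x] final_state_carrier_vnorm(1)[OF assms, of y]
    by (simp add: vnorm_square)
  finally show ?thesis
    unfolding node_loss_eq[OF assms] by (simp add: outcome_prob_def)
qed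

text \<open>All runs begin in the same state, so \<open>run_deviation\<close> starts from distance 0
  and gives at most \<open>2 * t\<close> after \<open>t\<close> queries; squaring and halving yields
  the bound.\<close>

lemma sum_node_loss_le:
  assumes "valid_qdtree n A"
  shows "(\<Sum>j<n. node_loss n (zeros n) (single n j) A) \<le> 2 * (real (queries A))\<^sup>2"
proof -
  let ?D = "\<lambda>j. vnorm (final_state n (zeros n) A - final_state n (single n j) A)"
  let ?\<psi> = "first_unitary A *\<^sub>v unit_vec (state_dim n A) (basis_index (work_dim A) 0 False 0)"
  have "vnorm (?\<psi> - ?\<psi>) = 0"
    using start_state(1)[OF assms] by (simp add: vnorm_def L2_set_0')
  then have "L2_set ?D {..<n} \<le> 2 * queries A"
    using run_deviation[OF _ start_state[OF assms] start_state(1)[OF assms], of "later_unitaries A"]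
      assms start_state(1)[OF assms]
    by (simp add: final_state_def valid_qdtree_def state_dim_def queries_def L2_set_0')
  then have "(L2_set ?D {..<n})\<^sup>2 \<le> (2 * real (queries A))\<^sup>2"
    by (intro power_mono) auto
  then have "(\<Sum>j<n. (?D j)\<^sup>2) \<le> 4 * (real (queries A))\<^sup>2"
    by (simp add: L2_set_def sum_nonneg)
  moreover have "(\<Sum>j<n. 2 * node_loss n (zeros n) (single n j) A) \<le> (\<Sum>j<n. (?D j)\<^sup>2)"
    by (intro sum_mono node_loss_le[OF assms])
  ultimately show ?thesis
    by (simp flip: sum_distrib_left)
qed

section \<open>Hellinger distance along hybrid trees\<close>

text \<open>The expected sum of the node losses met on the path taken on input
  \<open>x\<close>.\<close>

fun hellinger_loss :: "nat \<Rightarrow> bool list \<Rightarrow> bool list \<Rightarrow> hybrid_tree \<Rightarrow> real" where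
  "hellinger_loss n x y (Leaf z) = 0"
| "hellinger_loss n x y (Node A Ts) = node_loss n x y A +
     (\<Sum>k<length Ts. outcome_prob n x A k * map (\<lambda>T. hellinger_loss n x y T) Ts ! k)"

lemma hellinger_loss_nonneg: "valid_hybrid_tree n T \<Longrightarrow> 0 \<le> hellinger_loss n x y T"
proof (induction T)
  case (Node A Ts)
  then show ?case
    by (auto intro!: add_nonneg_nonneg node_loss_nonneg sum_nonneg mult_nonneg_nonneg
        simp: outcome_prob_nonneg)
qed simp

lemma output_prob_nonneg: "0 \<le> output_prob n x T z"
proof (induction T)
  case (Node A Ts)
  then show ?case
    by (auto intro!: sum_nonneg mult_nonneg_nonneg simp: outcome_prob_nonneg)
qed simp

lemma output_prob_add:
  "valid_hybrid_tree n T \<Longrightarrow> output_prob n x T True + output_prob n x T False = 1"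
proof (induction T)
  case (Node A Ts)
  have "output_prob n x (Node A Ts) True + output_prob n x (Node A Ts) False =
      (\<Sum>k<length Ts. outcome_prob n x A k *
        (output_prob n x (Ts ! k) True + output_prob n x (Ts ! k) False))"
    by (simp add: sum.distrib distrib_left)
  also have "\<dots> = (\<Sum>k<length Ts. outcome_prob n x A k)"
    using Node by (intro sum.cong) auto
  also have "\<dots> = 1"
    using Node.prems outcome_prob_sum[of n A x] by simp
  finally show ?case .
qed simp

text \<open>Cauchy-Schwarz for the vectors of square roots.\<close>

lemma sum_sqrt_mult_le:
  fixes a b :: "'i \<Rightarrow> real"
  assumes "\<And>i. i \<in> I \<Longrightarrow> 0 \<le> a i" "\<And>i. i \<in> I \<Longrightarrow> 0 \<le> b i"
  shows "(\<Sum>i\<in>I. sqrt (a i * b i)) \<le> sqrt ((\<Sum>i\<in>I. a i) * (\<Sum>i\<in>I. b i))"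
proof -
  have "(\<Sum>i\<in>I. sqrt (a i * b i)) = (\<Sum>i\<in>I. \<bar>sqrt (a i)\<bar> * \<bar>sqrt (b i)\<bar>)"
    by (intro sum.cong refl) (simp add: assms real_sqrt_mult)
  also have "\<dots> \<le> L2_set (\<lambda>i. sqrt (a i)) I * L2_set (\<lambda>i. sqrt (b i)) I"
    by (rule L2_set_mult_ineq)
  also have "\<dots> = sqrt ((\<Sum>i\<in>I. a i) * (\<Sum>i\<in>I. b i))"
    by (simp add: L2_set_def assms real_sqrt_mult)
  finally show ?thesis .
qed

text \<open>Here \<open>sqrt p\<close> is at most half of \<open>sqrt q\<close>, so the gap is at
  least \<open>sqrt q / 2\<close>, while \<open>p + q\<close> is at most
  \<open>5 / 4 * q\<close>.\<close>

lemma add_le_sqrt_gap: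
  fixes p q :: real
  assumes "0 \<le> p" "4 * p \<le> q"
  shows "p + q \<le> 5 * (sqrt p - sqrt q)\<^sup>2"
proof -
  have "sqrt (4 * p) \<le> sqrt q"
    using assms by (intro real_sqrt_le_mono)
  then have "2 * sqrt p \<le> sqrt q"
    by (simp add: real_sqrt_mult)
  then have "(sqrt q / 2)\<^sup>2 \<le> (sqrt q - sqrt p)\<^sup>2"
    using assms by (intro power_mono) auto
  then show ?thesis
    using assms by (simp add: power_divide power2_commute)
qed

text \<open>
  The loss is weighted by the probabilities on \<open>x\<close> alone, which is what allows averaging over
  \<open>y\<close> later on.  Subtrees whose weight \<open>q\<close> under \<open>y\<close> exceeds four times the weight \<open>p\<close> under \<open>x\<close>
  are paid for entirely by \<open>(sqrt p - sqrt q)\<^sup>2\<close>; otherwise \<open>sqrt (p * q) \<le> 2 * p\<close> turns a loss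
  weighted by \<open>sqrt (p * q)\<close> into one weighted by \<open>p\<close>.
\<close>

lemma tree_hellinger:
  assumes "valid_hybrid_tree n T" "0 \<le> p" "0 \<le> q"
  shows "p + q - 2 * (\<Sum>z\<in>UNIV. sqrt (p * output_prob n x T z * (q * output_prob n y T z)))
    \<le> 5 * (sqrt p - sqrt q)\<^sup>2 + 20 * p * hellinger_loss n x y T"
  using assms
proof (induction T arbitrary: p q)
  case (Leaf z)
  have "p + q - 2 * (\<Sum>z'\<in>UNIV. sqrt (p * output_prob n x (Leaf z) z' * (q * output_prob n y (Leaf z) z')))
      = (sqrt p - sqrt q)\<^sup>2"
    using Leaf by (cases z) (auto simp: UNIV_bool real_sqrt_mult power2_diff)
  then show ?case
    by simp
next
  case (Node A Ts)
  let ?T = "Node A Ts" and ?L = "hellinger_loss n x y"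
  let ?P = "\<lambda>k. outcome_prob n x A k" and ?R = "\<lambda>k. outcome_prob n y A k"
  have A: "valid_qdtree n A" "length Ts = state_dim n A" "\<And>k. k < length Ts \<Longrightarrow> valid_hybrid_tree n (Ts ! k)"
    using Node.prems by auto
  show ?case
  proof (cases "4 * p \<le> q")
    case True
    have "0 \<le> (\<Sum>z\<in>UNIV. sqrt (p * output_prob n x ?T z * (q * output_prob n y ?T z)))"
      using Node.prems(2,3) by (intro sum_nonneg real_sqrt_ge_zero mult_nonneg_nonneg output_prob_nonneg)
    moreover have "0 \<le> 20 * p * ?L ?T"
      using hellinger_loss_nonneg[OF Node.prems(1)] Node.prems(2) by simp
    ultimately show ?thesis
      using add_le_sqrt_gap[OF Node.prems(2) True] by linarith
  next
    case False
    let ?S = "\<lambda>k z. sqrt (p * ?P k * output_prob n x (Ts ! k) z * (q * ?R k * output_prob n y (Ts ! k) z))"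
    have "(\<Sum>k<length Ts. \<Sum>z\<in>UNIV. ?S k z) = (\<Sum>z\<in>UNIV. \<Sum>k<length Ts. ?S k z)"
      by (rule sum.swap)
    \<comment> \<open>Merging the outputs of different children can only increase the overlap of the
      two distributions.\<close>
    also have "\<dots> \<le> (\<Sum>z\<in>UNIV. sqrt ((\<Sum>k<length Ts. p * ?P k * output_prob n x (Ts ! k) z) *
        (\<Sum>k<length Ts. q * ?R k * output_prob n y (Ts ! k) z)))"
      using Node.prems(2,3)
      by (intro sum_mono sum_sqrt_mult_le) (auto simp: output_prob_nonneg outcome_prob_nonneg)
    also have "\<dots> = (\<Sum>z\<in>UNIV. sqrt (p * output_prob n x ?T z * (q * output_prob n y ?T z)))"
      by (simp add: sum_distrib_left mult.assoc)
    finally have cs: "(\<Sum>k<length Ts. \<Sum>z\<in>UNIV. ?S k z) \<le> \<dots>" .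
    have "p + q = (\<Sum>k<length Ts. p * ?P k + q * ?R k)"
      using outcome_prob_sum[OF A(1)] A(2) by (simp add: sum.distrib flip: sum_distrib_left)
    with cs have "p + q - 2 * (\<Sum>z\<in>UNIV. sqrt (p * output_prob n x ?T z * (q * output_prob n y ?T z)))
        \<le> (\<Sum>k<length Ts. p * ?P k + q * ?R k) - 2 * (\<Sum>k<length Ts. \<Sum>z\<in>UNIV. ?S k z)"
      by linarith
    also have "\<dots> = (\<Sum>k<length Ts. p * ?P k + q * ?R k - 2 * (\<Sum>z\<in>UNIV. ?S k z))"
      by (simp only: sum_subtractf sum_distrib_left)
    \<comment> \<open>Child \<open>k\<close> is reached with weights \<open>p * ?P k\<close> and
      \<open>q * ?R k\<close>; the induction therefore needs arbitrary weights.\<close>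
    also have "\<dots> \<le> (\<Sum>k<length Ts. 5 * (sqrt (p * ?P k) - sqrt (q * ?R k))\<^sup>2 + 20 * (p * ?P k) * ?L (Ts ! k))"
      using Node.prems A(3) by (intro sum_mono Node.IH) (auto simp: outcome_prob_nonneg)
    also have "\<dots> = 5 * (\<Sum>k<length Ts. (sqrt (p * ?P k) - sqrt (q * ?R k))\<^sup>2) +
        20 * p * (\<Sum>k<length Ts. ?P k * ?L (Ts ! k))"
      by (simp add: sum.distrib sum_distrib_left mult.assoc)
    also have "(\<Sum>k<length Ts. (sqrt (p * ?P k) - sqrt (q * ?R k))\<^sup>2) =
        (\<Sum>k<length Ts. p * ?P k + q * ?R k - 2 * (sqrt (p * q) * sqrt (?P k * ?R k)))"
      using Node.prems(2,3)
      by (intro sum.cong refl) (simp add: power2_diff real_sqrt_mult power_mult_distrib outcome_prob_nonneg)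
    also have "\<dots> = p + q - 2 * (sqrt (p * q) * (1 - node_loss n x y A))"
      using outcome_prob_sum[OF A(1)] A(2)
      by (simp add: sum.distrib sum_subtractf node_loss_def flip: sum_distrib_left)
    also have "\<dots> = (sqrt p - sqrt q)\<^sup>2 + 2 * sqrt (p * q) * node_loss n x y A"
      using Node.prems(2,3) by (simp add: power2_diff real_sqrt_mult algebra_simps)
    finally have chain: "p + q - 2 * (\<Sum>z\<in>UNIV. sqrt (p * output_prob n x ?T z * (q * output_prob n y ?T z)))
        \<le> 5 * ((sqrt p - sqrt q)\<^sup>2 + 2 * sqrt (p * q) * node_loss n x y A) +
          20 * p * (\<Sum>k<length Ts. ?P k * ?L (Ts ! k))" .
    have "p * q \<le> (2 * p)\<^sup>2"
      using mult_left_mono[of q "4 * p" p] False Node.prems(2) by (simp add: power2_eq_square)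
    then have "sqrt (p * q) \<le> 2 * p"
      using Node.prems(2) by (intro real_le_lsqrt) auto
    \<comment> \<open>Together with the factor 5 in \<open>chain\<close>, this accounts for the
      constant 20.\<close>
    then have "2 * sqrt (p * q) * node_loss n x y A \<le> 2 * (2 * p) * node_loss n x y A"
      using node_loss_nonneg[OF A(1)] by (intro mult_right_mono) auto
    with chain show ?thesis
      by (simp add: algebra_simps)
  qed
qed

section \<open>Path costs, the total loss of a tree and the lower bound\<close>

lemma finite_path_costs: "finite (path_costs T)"
  by (induction T) auto

lemma path_costs_nonempty: "valid_hybrid_tree n T \<Longrightarrow> path_costs T \<noteq> {}"
proof (induction T)
  case (Node A Ts)
  then have "Ts \<noteq> []"
    by (auto simp: valid_qdtree_def)
  then obtain T where "T \<in> set Ts"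
    by (cases Ts) auto
  with Node show ?case
    by auto
qed simp

lemma cost_child:
  assumes "valid_hybrid_tree n (Node A Ts)" "T \<in> set Ts"
  shows "queries A + cost T \<le> cost (Node A Ts)"
proof -
  have "cost T \<in> path_costs T"
    unfolding cost_def using assms finite_path_costs path_costs_nonempty[of n T] by (intro Max_in) auto
  then have "queries A + cost T \<in> path_costs (Node A Ts)"
    using assms(2) by auto
  then show ?thesis
    unfolding cost_def by (intro Max_ge finite_path_costs)
qed

text \<open>Every node of a valid tree lies on a root-to-leaf path, so its queries are counted in
  some path cost. This supplies the choice of limit behind the \<open>sqrt n\<close> term.\<close>

lemma limited_cost: "valid_hybrid_tree n T \<Longrightarrow> limited (cost T) T"
proof -
  \<comment> \<open>A bound \<open>r\<close> independent of the tree lets the induction hypothesis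
    apply to the cheaper children.\<close>
  have "valid_hybrid_tree n T \<Longrightarrow> cost T \<le> r \<Longrightarrow> limited r T" for r
  proof (induction T)
    case (Node A Ts)
    have le: "queries A + cost T \<le> r" if "T \<in> set Ts" for T
      using cost_child[OF Node.prems(1) that] Node.prems(2) by linarith
    have "Ts \<noteq> []"
      using Node.prems(1) by (auto simp: valid_qdtree_def)
    then have "hd Ts \<in> set Ts"
      by simp
    then have "queries A \<le> r"
      using le by fastforce
    moreover have "limited r T" if "T \<in> set Ts" for T
      using Node.IH[OF that] Node.prems(1) le[OF that] that by simp
    ultimately show ?case
      by simp
  qed simp
  then show "valid_hybrid_tree n T \<Longrightarrow> limited (cost T) T"
    by simp
qed

text \<open>The branching weights belong to the zero string and do not depend on \<open>j\<close>,
  so the sum over \<open>j\<close> moves inside the expectation. A node with \<open>t <= r\<close>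
  queries contributes at most \<open>2 * t^2 <= 2 * r * t\<close>, and the children share the
  remaining cost.\<close>

lemma sum_hellinger_loss_le:
  assumes "valid_hybrid_tree n T" "limited r T"
  shows "(\<Sum>j<n. hellinger_loss n (zeros n) (single n j) T) \<le> 2 * real r * real (cost T)"
  using assms
proof (induction T)
  case (Node A Ts)
  let ?P = "\<lambda>k. outcome_prob n (zeros n) A k"
  let ?L = "\<lambda>j. hellinger_loss n (zeros n) (single n j)"
  have A: "valid_qdtree n A" "length Ts = state_dim n A" "queries A \<le> r"
    using Node.prems by auto
  have child: "(\<Sum>j<n. ?L j (Ts ! k)) \<le> 2 * real r * (real (cost (Node A Ts)) - queries A)"
    if "k < length Ts" for k
  proof -
    have "Ts ! k \<in> set Ts"
      using that by simp
    then have "(\<Sum>j<n. ?L j (Ts ! k)) \<le> 2 * real r * real (cost (Ts ! k))"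
      using Node by auto
    also have "\<dots> \<le> 2 * real r * (real (cost (Node A Ts)) - queries A)"
      using cost_child[OF Node.prems(1) \<open>Ts ! k \<in> set Ts\<close>] by (intro mult_left_mono) auto
    finally show ?thesis .
  qed
  have "(\<Sum>j<n. ?L j (Node A Ts)) = (\<Sum>j<n. node_loss n (zeros n) (single n j) A) +
      (\<Sum>j<n. \<Sum>k<length Ts. ?P k * ?L j (Ts ! k))"
    by (simp add: sum.distrib)
  also have "(\<Sum>j<n. \<Sum>k<length Ts. ?P k * ?L j (Ts ! k)) = (\<Sum>k<length Ts. ?P k * (\<Sum>j<n. ?L j (Ts ! k)))"
    by (subst sum.swap) (simp add: sum_distrib_left)
  also have "\<dots> \<le> (\<Sum>k<length Ts. ?P k * (2 * real r * (real (cost (Node A Ts)) - queries A)))"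
    by (intro sum_mono mult_left_mono child) (auto simp: outcome_prob_nonneg)
  also have "\<dots> = 2 * real r * (real (cost (Node A Ts)) - queries A)"
    using outcome_prob_sum[OF A(1)] A(2) by (simp flip: sum_distrib_right)
  also have "(\<Sum>j<n. node_loss n (zeros n) (single n j) A) \<le> 2 * real r * queries A"
    using sum_node_loss_le[OF A(1)] A(3)
    by (elim order_trans) (auto simp: power2_eq_square intro: mult_right_mono)
  finally show ?case
    by (simp add: algebra_simps)
qed simp

lemma partial_or_zeros: "partial_or n (zeros n) = Some False"
  by (simp add: partial_or_def count_list_0_iff)

lemma partial_or_single: "j < n \<Longrightarrow> partial_or n (single n j) = Some True"
proof -
  assume j: "j < n"
  have "single n j = replicate j False @ True # replicate (n - Suc j) False"
    using j by (intro nth_equalityI) (auto simp: single_def nth_append nth_Cons' nth_list_update)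
  then have "count_list (single n j) True = 1"
    by (simp add: count_list_0_iff)
  moreover have "length (single n j) = n" "single n j ! j"
    using j by (auto simp: single_def)
  ultimately show ?thesis
    using j by (auto simp: partial_or_def)
qed

lemma limited_cost_lower_bound:
  assumes T: "valid_hybrid_tree n T" "limited r T" and "computes n T (partial_or n)"
  shows "real n \<le> 350 * real r * real (cost T)"
proof -
  have "1 / 175 \<le> hellinger_loss n (zeros n) (single n j) T" if j: "j < n" for j
  proof -
    let ?a = "output_prob n (zeros n) T" and ?b = "output_prob n (single n j) T"
    have "2 / 3 \<le> ?a False" "2 / 3 \<le> ?b True"
      using assms(3) partial_or_zeros partial_or_single[OF j] by (auto simp: computes_def)
    \<comment> \<open>AM-GM with weights near the optimal \<open>sqrt (1 / 2)\<close> and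
      \<open>sqrt 2\<close> for probabilities 2/3 and 1/3. The overlap is then at most 33/35, so
      \<open>20 * loss >= 2 - 66/35 = 4/35\<close>, which is the 1/175.\<close>
    moreover have "sqrt (?a False * ?b False) \<le> (5 / 7 * ?a False + 7 / 5 * ?b False) / 2"
      using arith_geo_mean_sqrt[of "5 / 7 * ?a False" "7 / 5 * ?b False"]
      by (simp add: output_prob_nonneg mult.commute)
    moreover have "sqrt (?a True * ?b True) \<le> (7 / 5 * ?a True + 5 / 7 * ?b True) / 2"
      using arith_geo_mean_sqrt[of "7 / 5 * ?a True" "5 / 7 * ?b True"]
      by (simp add: output_prob_nonneg mult.commute)
    moreover note output_prob_add[OF T(1), of "zeros n"] output_prob_add[OF T(1), of "single n j"]
    ultimately show ?thesis
      using tree_hellinger[OF T(1), of 1 1 "zeros n" "single n j"] by (simp add: UNIV_bool)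
  qed
  then have "(\<Sum>j<n. 1 / 175) \<le> (\<Sum>j<n. hellinger_loss n (zeros n) (single n j) T)"
    by (intro sum_mono) simp
  with sum_hellinger_loss_le[OF T] show ?thesis
    by simp
qed

section \<open>Exact Grover search\<close>

definition rvec :: "nat \<Rightarrow> (nat \<Rightarrow> real) \<Rightarrow> complex vec" where
  "rvec d f = vec d (\<lambda>i. complex_of_real (f i))"

text \<open>For a unit vector \<open>w\<close> this fixes \<open>w\<close> and negates its
  orthogonal complement.\<close>

definition reflection :: "nat \<Rightarrow> (nat \<Rightarrow> real) \<Rightarrow> complex mat" where
  "reflection d w = mat d d (\<lambda>(i, j). complex_of_real (2 * w i * w j - of_bool (i = j)))"

lemma rvec_carrier [simp]: "rvec d f \<in> carrier_vec d"
  by (simp add: rvec_def)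

lemma reflection_carrier [simp]: "reflection d w \<in> carrier_mat d d"
  by (simp add: reflection_def)

lemma reflection_apply:
  "reflection d w *\<^sub>v rvec d f = rvec d (\<lambda>i. 2 * (\<Sum>j<d. w j * f j) * w i - f i)"
proof (rule eq_vecI)
  fix i assume "i < dim_vec (rvec d (\<lambda>i. 2 * (\<Sum>j<d. w j * f j) * w i - f i))"
  then have i: "i < d"
    by (simp add: rvec_def)
  have "(\<Sum>j<d. (2 * w i * w j - of_bool (i = j)) * f j) =
      (\<Sum>j<d. 2 * w i * (w j * f j) - (if j = i then f j else 0))"
    by (intro sum.cong) (auto simp: algebra_simps)
  also have "\<dots> = 2 * (\<Sum>j<d. w j * f j) * w i - f i"
    using i by (simp add: sum_subtractf flip: sum_distrib_left)
  finally have "complex_of_real (\<Sum>j<d. (2 * w i * w j - of_bool (i = j)) * f j) =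
      complex_of_real (2 * (\<Sum>j<d. w j * f j) * w i - f i)"
    by (rule arg_cong)
  moreover have "(reflection d w *\<^sub>v rvec d f) $ i =
      complex_of_real (\<Sum>j<d. (2 * w i * w j - of_bool (i = j)) * f j)"
    using i by (simp add: reflection_def rvec_def scalar_prod_def atLeast0LessThan)
  ultimately show "(reflection d w *\<^sub>v rvec d f) $ i = rvec d (\<lambda>i. 2 * (\<Sum>j<d. w j * f j) * w i - f i) $ i"
    using i by (simp add: rvec_def)
qed (simp add: rvec_def reflection_def)

text \<open>The matrix is real symmetric, and it is an involution when \<open>w\<close> has norm
  1.\<close>

lemma unitary_reflection:
  assumes "(\<Sum>j<d. (w j)\<^sup>2) = 1"
  shows "unitary d (reflection d w)"
proof -
  have "reflection d w * reflection d w = 1\<^sub>m d"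
  proof (rule eq_matI)
    fix i k assume "i < dim_row (1\<^sub>m d)" "k < dim_col (1\<^sub>m d)"
    then have ik: "i < d" "k < d"
      by auto
    have "(\<Sum>j<d. (2 * w i * w j - of_bool (i = j)) * (2 * w j * w k - of_bool (j = k))) =
        (\<Sum>j<d. 4 * w i * w k * (w j)\<^sup>2 - (if j = i then 2 * w j * w k else 0)
          - (if j = k then 2 * w i * w j else 0) + (if j = i then of_bool (i = k) else 0))"
      by (intro sum.cong) (auto simp: algebra_simps power2_eq_square)
    also have "\<dots> = of_bool (i = k)"
      using ik by (simp add: sum.distrib sum_subtractf assms flip: sum_distrib_left)
    finally have "complex_of_real (\<Sum>j<d. (2 * w i * w j - of_bool (i = j)) * (2 * w j * w k - of_bool (j = k))) =
        complex_of_real (of_bool (i = k))"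
      by (rule arg_cong)
    moreover have "(reflection d w * reflection d w) $$ (i, k) =
      complex_of_real (\<Sum>j<d. (2 * w i * w j - of_bool (i = j)) * (2 * w j * w k - of_bool (j = k)))"
      using ik by (simp add: reflection_def scalar_prod_def atLeast0LessThan)
    ultimately show "(reflection d w * reflection d w) $$ (i, k) = 1\<^sub>m d $$ (i, k)"
      using ik by simp
  qed (simp_all add: reflection_def)
  moreover have "mat_adjoint (reflection d w) = reflection d w"
    using mat_adjoint_carrier[OF reflection_carrier[of d w]]
    by (intro eq_matI) (auto simp: mat_adjoint_index reflection_def mult_ac)
  ultimately show ?thesis
    by (simp add: unitary_def)
qed

text \<open>Groups the two basis states of each position, turning sums over basis states into sums
  over positions.\<close>

lemma sum_pairs: "(\<Sum>r<n * 2. g r) = (\<Sum>i<n. g (2 * i) + g (2 * i + 1 :: nat) :: real)"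
  by (induction n) (auto simp: mult.commute)

lemma flip_Suc_0:
  "flip (Suc 0) x r = (if x ! (r div 2) then (if odd r then r - 1 else r + 1) else r)"
  by (auto simp: flip_def basis_index_def query_reg_def target_reg_def work_reg_def elim!: evenE oddE)

lemma query_mat_rvec:
  "query_mat n (Suc 0) x *\<^sub>v rvec (n * 2) f = rvec (n * 2) (\<lambda>r. f (flip (Suc 0) x r))"
proof (rule eq_vecI)
  fix r assume "r < dim_vec (rvec (n * 2) (\<lambda>r. f (flip (Suc 0) x r)))"
  then have r: "r < n * 2"
    by (simp add: rvec_def)
  show "(query_mat n (Suc 0) x *\<^sub>v rvec (n * 2) f) $ r = rvec (n * 2) (\<lambda>r. f (flip (Suc 0) x r)) $ r"
    using query_mat_apply[of "rvec (n * 2) f" n "Suc 0" r x] r flip_less[of r n "Suc 0" x]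
    by (simp add: rvec_def del: index_mult_mat_vec)
qed (use query_mat_carrier[of n "Suc 0" x] in \<open>auto simp: rvec_def\<close>)

text \<open>
  With workspace dimension \<open>1\<close> the basis state \<open>|i\<rangle>|b\<rangle>\<close> has index \<open>2 * i + b\<close>.  The start state
  has amplitude \<open>s\<close> on each \<open>|i\<rangle>|-\<rangle>\<close> with \<open>i \<in> S\<close>, and the remaining weight sits on \<open>|0\<rangle>|+\<rangle>\<close>,
  which is orthogonal to all of these and fixed by every query; so \<open>s\<close> can be tuned freely to
  make the Grover rotation exact.
\<close>

definition minus_state :: "nat set \<Rightarrow> nat \<Rightarrow> real" where
  "minus_state S r = of_bool (r div 2 \<in> S) * (- 1) ^ r / sqrt 2"

definition grover_start :: "real \<Rightarrow> nat set \<Rightarrow> nat \<Rightarrow> real" where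
  "grover_start s S r = s * minus_state S r +
     of_bool (r div 2 = 0) * sqrt (1 - real (card S) * s\<^sup>2) / sqrt 2"

text \<open>Phase kickback: exchanging the two values of the target bit negates the minus
  state.\<close>

lemma minus_state_flip:
  "minus_state S (flip (Suc 0) x r) = (if x ! (r div 2) then - minus_state S r else minus_state S r)"
  by (auto simp: flip_Suc_0 minus_state_def elim!: evenE oddE)

lemma flip_div: "flip (Suc 0) x r div 2 = r div 2"
  by (auto simp: flip_Suc_0 elim!: evenE oddE)

text \<open>At position 0 the minus and plus parts are orthogonal, so their cross terms cancel even
  if 0 lies in \<open>S\<close>. The bound on \<open>s\<close> keeps the radicand
  nonnegative.\<close>

lemma grover_start_norm:
  assumes "S \<subseteq> {..<n}" "real (card S) * s\<^sup>2 \<le> 1" "0 < n"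
  shows "(\<Sum>r<n * 2. (grover_start s S r)\<^sup>2) = 1"
proof -
  let ?c = "1 - real (card S) * s\<^sup>2"
  have "(\<Sum>r<n * 2. (grover_start s S r)\<^sup>2) =
      (\<Sum>i<n. (if i \<in> S then s\<^sup>2 else 0) + (if i = 0 then ?c else 0))"
    unfolding sum_pairs using assms(2)
    by (intro sum.cong) (auto simp: grover_start_def minus_state_def power_divide power2_diff power2_sum
        diff_divide_distrib[symmetric] add_divide_distrib[symmetric] field_simps)
  also have "\<dots> = real (card S) * s\<^sup>2 + ?c"
    using assms(1,3) by (simp add: sum.distrib sum.If_cases Int_absorb1)
  finally show ?thesis
    by simp
qed

lemma grover_start_minus_state:
  assumes "j \<in> S" "j < n"
  shows "(\<Sum>r<n * 2. grover_start s S r * minus_state {j} r) = s"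
proof -
  have "(\<Sum>r<n * 2. grover_start s S r * minus_state {j} r) = (\<Sum>i<n. if i = j then s else 0)"
    unfolding sum_pairs using assms
    by (intro sum.cong) (auto simp: grover_start_def minus_state_def field_simps)
  then show ?thesis
    using assms by simp
qed

text \<open>Reduces a run to closed forms: \<open>\<psi> t\<close> after \<open>t\<close> rounds,
  \<open>\<chi> t\<close> between the following query and its reflection.\<close>

lemma foldl_grover:
  assumes "\<And>t. query_mat n (Suc 0) x *\<^sub>v rvec (n * 2) (\<psi> t) = rvec (n * 2) (\<chi> t)"
    and "\<And>t. reflection (n * 2) u *\<^sub>v rvec (n * 2) (\<chi> t) = rvec (n * 2) (\<psi> (Suc t))"
  shows "foldl (step n (Suc 0) x) (rvec (n * 2) (\<psi> 0)) (replicate t (reflection (n * 2) u)) =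
    rvec (n * 2) (\<psi> t)"
proof (induction t)
  case (Suc t)
  have "replicate (Suc t) (reflection (n * 2) u) =
      replicate t (reflection (n * 2) u) @ [reflection (n * 2) u]"
    by (simp add: replicate_append_same)
  then show ?case
    using Suc assms by (simp del: replicate_Suc)
qed simp

text \<open>The usual Grover state at angle \<open>(2 * t + 1) * \<theta>\<close>, written in the
  oblique basis of the start state and the marked state. For \<open>j\<close> in \<open>S\<close>
  these have overlap \<open>sin \<theta>\<close>, hence the divisions by
  \<open>cos \<theta>\<close>.\<close>

definition rotated :: "real \<Rightarrow> nat set \<Rightarrow> nat \<Rightarrow> nat \<Rightarrow> nat \<Rightarrow> real" where
  "rotated \<theta> S j t r = cos (real (2 * t + 1) * \<theta>) / cos \<theta> * grover_start (sin \<theta>) S r +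
     sin (real (2 * t) * \<theta>) / cos \<theta> * minus_state {j} r"

lemma grover_start_flip:
  assumes "\<And>i. i \<in> S \<Longrightarrow> \<not> x ! i"
  shows "grover_start s S (flip (Suc 0) x r) = grover_start s S r"
proof -
  have "minus_state S (flip (Suc 0) x r) = minus_state S r"
    unfolding minus_state_flip using assms by (auto simp: minus_state_def)
  then show ?thesis
    by (simp add: grover_start_def flip_div)
qed

lemma grover_start_flip_single:
  assumes "j \<in> S" "S \<subseteq> {..<n}" "r < n * 2"
  shows "grover_start s S (flip (Suc 0) (single n j) r) =
    grover_start s S r - 2 * s * minus_state {j} r"
proof -
  have "r div 2 < n"
    using assms(3) by auto
  then show ?thesis
    using assms(1) by (auto simp: grover_start_def flip_div minus_state_flip single_nth) 
      (auto simp: minus_state_def)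
qed

lemma rotated_overlap:
  assumes "j \<in> S" "S \<subseteq> {..<n}" "real (card S) * (sin \<theta>)\<^sup>2 \<le> 1" "cos \<theta> \<noteq> 0"
  shows "(\<Sum>r<n * 2. grover_start (sin \<theta>) S r * rotated \<theta> S j t r) = cos (real (2 * t) * \<theta>)"
proof -
  let ?u = "grover_start (sin \<theta>) S" and ?a = "cos (real (2 * t + 1) * \<theta>) / cos \<theta>"
    and ?b = "sin (real (2 * t) * \<theta>) / cos \<theta>"
  have n: "0 < n" "j < n"
    using assms(1,2) by auto
  have "(\<Sum>r<n * 2. ?u r * rotated \<theta> S j t r) =
      ?a * (\<Sum>r<n * 2. (?u r)\<^sup>2) + ?b * (\<Sum>r<n * 2. ?u r * minus_state {j} r)"
  proof -
    have "?u r * rotated \<theta> S j t r = ?a * (?u r)\<^sup>2 + ?b * (?u r * minus_state {j} r)" for r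
      unfolding rotated_def power2_eq_square by (simp only: distrib_left mult_ac)
    then show ?thesis
      by (simp only: sum.distrib sum_distrib_left)
  qed
  also have "\<dots> = ?a + ?b * sin \<theta>"
    using grover_start_norm[OF assms(2,3) n(1)] grover_start_minus_state[OF assms(1) n(2)] by simp
  also have "real (2 * t + 1) * \<theta> = real (2 * t) * \<theta> + \<theta>"
    by (simp add: algebra_simps)
  also note cos_add
  finally show ?thesis
    using assms(4) by (simp add: field_simps)
qed

text \<open>The query negates the marked component \<open>sin ((2 * t + 1) * \<theta>)\<close>,
  which gives \<open>\<chi>\<close>. Reflecting \<open>\<chi>\<close> at the start state then
  advances the angle by \<open>2 * \<theta>\<close>.\<close>

lemma rotated_step:
  fixes t :: nat
  assumes "j \<in> S" "S \<subseteq> {..<n}" "real (card S) * (sin \<theta>)\<^sup>2 \<le> 1" "cos \<theta> \<noteq> 0"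
  defines "\<chi> \<equiv> \<lambda>r. rotated \<theta> S j t r -
    2 * (sin (real (2 * t + 1) * \<theta>)) * minus_state {j} r"
  shows "query_mat n (Suc 0) (single n j) *\<^sub>v rvec (n * 2) (rotated \<theta> S j t) = rvec (n * 2) \<chi>"
    and "reflection (n * 2) (grover_start (sin \<theta>) S) *\<^sub>v rvec (n * 2) \<chi> =
      rvec (n * 2) (rotated \<theta> S j (Suc t))"
proof -
  let ?u = "grover_start (sin \<theta>) S" and ?v = "minus_state {j}"
  define \<beta> where "\<beta> = real (2 * t) * \<theta>"
  have ang: "real (2 * t + 1) * \<theta> = \<beta> + \<theta>" "real (2 * t) * \<theta> = \<beta>"
    "real (2 * Suc t + 1) * \<theta> = \<beta> + \<theta> + 2 * \<theta>" "real (2 * Suc t) * \<theta> = \<beta> + 2 * \<theta>"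
    by (simp_all add: \<beta>_def algebra_simps)
  have n: "0 < n" "j < n"
    using assms(1,2) by auto
  have rot: "rotated \<theta> S j t r = cos (\<beta> + \<theta>) / cos \<theta> * ?u r + sin \<beta> / cos \<theta> * ?v r"
    "rotated \<theta> S j (Suc t) r =
      cos (\<beta> + \<theta> + 2 * \<theta>) / cos \<theta> * ?u r + sin (\<beta> + 2 * \<theta>) / cos \<theta> * ?v r" for r
    by (simp_all only: rotated_def ang)
  have \<chi>: "\<chi> r = rotated \<theta> S j t r - 2 * sin (\<beta> + \<theta>) * ?v r" for r
    by (simp only: \<chi>_def ang)
  have "rotated \<theta> S j t (flip (Suc 0) (single n j) r) = \<chi> r" if "r < n * 2" for r
  proof -
    have "r div 2 < n"
      using that by auto
    then have "?v (flip (Suc 0) (single n j) r) = - ?v r"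
      by (auto simp: minus_state_flip single_nth) (auto simp: minus_state_def)
    then have "rotated \<theta> S j t (flip (Suc 0) (single n j) r) =
        cos (\<beta> + \<theta>) / cos \<theta> * (?u r - 2 * sin \<theta> * ?v r) - sin \<beta> / cos \<theta> * ?v r"
      by (simp add: rot(1) grover_start_flip_single[OF assms(1,2) that])
    also have "\<dots> = cos (\<beta> + \<theta>) / cos \<theta> * ?u r + sin \<beta> / cos \<theta> * ?v r -
        2 * ((cos (\<beta> + \<theta>) * sin \<theta> + sin \<beta>) / cos \<theta>) * ?v r"
      using assms(4) by (simp add: field_simps)
    \<comment> \<open>Expand \<open>sin \<beta>\<close> as the sine of the difference of
      \<open>\<beta> + \<theta>\<close> and \<open>\<theta>\<close>.\<close>
    also have "cos (\<beta> + \<theta>) * sin \<theta> + sin \<beta> = sin (\<beta> + \<theta>) * cos \<theta>"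
      using sin_diff[of "\<beta> + \<theta>" \<theta>] by simp
    finally show ?thesis
      using assms(4) by (simp add: \<chi> rot(1))
  qed
  then show "query_mat n (Suc 0) (single n j) *\<^sub>v rvec (n * 2) (rotated \<theta> S j t) = rvec (n * 2) \<chi>"
    unfolding query_mat_rvec by (intro eq_vecI) (auto simp: rvec_def)
  have "(\<Sum>r<n * 2. ?u r * \<chi> r) = (\<Sum>r<n * 2. ?u r * rotated \<theta> S j t r) -
      2 * sin (\<beta> + \<theta>) * (\<Sum>r<n * 2. ?u r * ?v r)"
    by (simp add: \<chi> sum_distrib_left algebra_simps flip: sum_subtractf)
  also have "\<dots> = cos \<beta> - 2 * sin (\<beta> + \<theta>) * sin \<theta>"
    using rotated_overlap[OF assms(1-4), of t] grover_start_minus_state[OF assms(1) n(2)] ang by simp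
  also have "\<dots> = cos (\<beta> + 2 * \<theta>)"
    using cos_diff[of "\<beta> + \<theta>" \<theta>] cos_add[of "\<beta> + \<theta>" \<theta>] by (simp add: algebra_simps)
  finally have ov: "(\<Sum>r<n * 2. ?u r * \<chi> r) = cos (\<beta> + 2 * \<theta>)" .
  have "2 * cos (\<beta> + 2 * \<theta>) * ?u r - \<chi> r = rotated \<theta> S j (Suc t) r" for r
  proof -
    have c: "cos (\<beta> + \<theta> + 2 * \<theta>) = 2 * cos (\<beta> + 2 * \<theta>) * cos \<theta> - cos (\<beta> + \<theta>)"
      using cos_add[of "\<beta> + 2 * \<theta>" \<theta>] cos_diff[of "\<beta> + 2 * \<theta>" \<theta>] by (simp add: algebra_simps)
    have d: "sin (\<beta> + 2 * \<theta>) = 2 * sin (\<beta> + \<theta>) * cos \<theta> - sin \<beta>"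
      using sin_add[of "\<beta> + \<theta>" \<theta>] sin_diff[of "\<beta> + \<theta>" \<theta>] by (simp add: algebra_simps)
    show ?thesis
      unfolding rot(2) c d using assms(4) by (simp add: \<chi> rot(1) field_simps)
  qed
  then show "reflection (n * 2) ?u *\<^sub>v rvec (n * 2) \<chi> = rvec (n * 2) (rotated \<theta> S j (Suc t))"
    by (simp add: reflection_apply ov)
qed

text \<open>
  The rotation by \<open>2 * \<theta>\<close> per query is chosen such that \<open>k\<close> queries turn the start state by exactly
  a right angle.  The reflection \<open>H\<close> at the bisector of \<open>|0\<rangle>|0\<rangle>\<close> and the start state \<open>u\<close> swaps the
  two, so it both prepares \<open>u\<close> and finally measures the overlap with \<open>u\<close>.
\<close>

lemma block_detector:
  assumes "0 < n" "0 < k" "S \<subseteq> {..<n}" "card S \<le> k\<^sup>2"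
  obtains A where "valid_qdtree n A" "queries A = k" "state_dim n A = n * 2"
    "\<And>x. (\<And>i. i \<in> S \<Longrightarrow> \<not> x ! i) \<Longrightarrow> outcome_prob n x A 0 = 1"
    "\<And>j. j \<in> S \<Longrightarrow> outcome_prob n (single n j) A 0 = 0"
proof -
  define d where "d = n * 2"
  define \<theta> where "\<theta> = pi / (4 * real k)"
  define u where "u = grover_start (sin \<theta>) S"
  \<comment> \<open>The norm of the sum of the unit vectors \<open>|0>|0>\<close> and
    \<open>u\<close>, so that \<open>w\<close> is their normalised bisector.\<close>
  define N where "N = sqrt (2 + 2 * u 0)"
  define w where "w = (\<lambda>i. (of_bool (i = 0) + u i) / N)"
  define H where "H = reflection d w"
  define D where "D = reflection d u"
  \<comment> \<open>The last reflection is fused with \<open>H\<close>, so the list has length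
    \<open>k\<close> and the measurement costs no query.\<close>
  define A where "A = QDTree 1 H (replicate (k - 1) D @ [H * D])"
  have k: "1 \<le> real k"
    using assms(2) by simp
  \<comment> \<open>Since \<open>pi < 4\<close>, \<open>sin \<theta>\<close> is at most
    \<open>1 / k\<close>; so \<open>k^2\<close> positions of amplitude \<open>sin \<theta>\<close>
    have total weight at most 1.\<close>
  have \<theta>: "0 < \<theta>" "\<theta> \<le> 1 / real k" "\<theta> < pi / 2"
    using k pi_less_4 by (auto simp: \<theta>_def field_simps)
  have s: "0 \<le> sin \<theta>" "sin \<theta> \<le> 1 / real k" "cos \<theta> \<noteq> 0"
    using \<theta> sin_x_le_x[of \<theta>] cos_gt_zero[of \<theta>] by (auto intro: sin_ge_zero)
  have "real (card S) * (sin \<theta>)\<^sup>2 \<le> (real k)\<^sup>2 * (1 / real k)\<^sup>2"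
    using s assms(4) by (intro mult_mono power_mono) (auto simp flip: of_nat_power)
  then have card: "real (card S) * (sin \<theta>)\<^sup>2 \<le> 1"
    using k by (simp add: power_divide)
  have "0 < d"
    using assms(1) by (simp add: d_def)
  have u_norm: "(\<Sum>r<d. (u r)\<^sup>2) = 1"
    using grover_start_norm[OF assms(3) card assms(1)] by (simp add: d_def u_def)
  have u0: "0 \<le> u 0"
    using s card by (simp add: u_def grover_start_def minus_state_def)
  then have N: "N\<^sup>2 = 2 + 2 * u 0" "N \<noteq> 0"
    by (auto simp: N_def)
  have w_sum: "(\<Sum>r<d. w r * f r) = (f 0 + (\<Sum>r<d. u r * f r)) / N" for f
  proof -
    have "(\<Sum>r<d. w r * f r) = (\<Sum>r<d. ((if r = 0 then f r else 0) + u r * f r) / N)"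
      by (intro sum.cong) (auto simp: w_def algebra_simps)
    then show ?thesis
      using \<open>0 < d\<close> by (simp add: sum.distrib flip: sum_divide_distrib)
  qed
  have w0: "w 0 = (1 + u 0) / N"
    by (simp add: w_def)
  have u_w: "(\<Sum>r<d. u r * w r) = (1 + u 0) / N"
  proof -
    have "(\<Sum>r<d. u r * w r) = (\<Sum>r<d. w r * u r)"
      by (simp add: mult.commute)
    then show ?thesis
      unfolding w_sum using u_norm by (simp add: power2_eq_square add.commute)
  qed
  have "(\<Sum>r<d. (w r)\<^sup>2) = (w 0 + (\<Sum>r<d. u r * w r)) / N"
    using w_sum[of w] by (simp add: power2_eq_square)
  also have "\<dots> = (2 + 2 * u 0) / N\<^sup>2"
    by (simp add: w0 u_w power2_eq_square add_divide_distrib)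
  also have "\<dots> = 1"
    using u0 unfolding N(1) by simp
  finally have w_norm: "(\<Sum>r<d. (w r)\<^sup>2) = 1" .
  have unitary: "unitary d H" "unitary d D" "unitary d (H * D)"
    using unitary_reflection[OF w_norm] unitary_reflection[OF u_norm]
    by (auto simp: H_def D_def intro: unitary_mult)
  have valid: "valid_qdtree n A" "queries A = k" "state_dim n A = n * 2"
    using unitary \<open>0 < d\<close> assms(2) by (auto simp: A_def valid_qdtree_def queries_def state_dim_def d_def)
  have half: "(1 + u 0) / N / N = 1 / 2"
    using N u0 by (simp add: power2_eq_square field_simps)
  have H_start: "H *\<^sub>v unit_vec d 0 = rvec d u"
  proof -
    have "unit_vec d 0 = rvec d (\<lambda>i. of_bool (i = 0))"
      by (rule eq_vecI) (auto simp: rvec_def unit_vec_def)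
    moreover have "(\<Sum>r<d. w r * of_bool (r = 0)) = w 0"
      using \<open>0 < d\<close> by (simp add: of_bool_def if_distrib cong: if_cong)
    moreover have "2 * w 0 * w i - of_bool (i = 0) = u i" for i
    proof -
      have "w 0 * w i = ((1 + u 0) / N / N) * (of_bool (i = 0) + u i)"
        by (simp add: w0 w_def)
      then show ?thesis
        unfolding half by simp
    qed
    ultimately show ?thesis
      by (simp add: H_def reflection_apply)
  qed
  \<comment> \<open>Row 0 of \<open>H\<close> is \<open>u\<close>: outcome 0 measures the overlap
    with the start state.\<close>
  have H_amp: "(H *\<^sub>v rvec d f) $ 0 = complex_of_real (\<Sum>r<d. u r * f r)" for f
  proof -
    have "(H *\<^sub>v rvec d f) $ 0 = complex_of_real (2 * (\<Sum>r<d. w r * f r) * w 0 - f 0)"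
      unfolding H_def reflection_apply using \<open>0 < d\<close> by (simp add: rvec_def)
    also have "(\<Sum>r<d. w r * f r) * w 0 = ((1 + u 0) / N / N) * (f 0 + (\<Sum>r<d. u r * f r))"
      unfolding w_sum w0 by simp
    then have "2 * (\<Sum>r<d. w r * f r) * w 0 - f 0 = (\<Sum>r<d. u r * f r)"
      unfolding half by simp
    finally show ?thesis .
  qed
  have final: "final_state n x A = H *\<^sub>v foldl (step n (Suc 0) x) (rvec d u) (replicate k D)" for x
  proof -
    let ?\<psi> = "foldl (step n (Suc 0) x) (rvec d u) (replicate (k - 1) D)"
    have "?\<psi> \<in> carrier_vec d"
      using run_carrier_vnorm[of "replicate (k - 1) D" n "Suc 0" "rvec d u" x] unitary
      by (simp add: d_def)
    then have "query_mat n (Suc 0) x *\<^sub>v ?\<psi> \<in> carrier_vec d"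
      using query_mat_carrier[of n "Suc 0" x] by (auto simp: d_def)
    then have "(H * D) *\<^sub>v (query_mat n (Suc 0) x *\<^sub>v ?\<psi>) =
        H *\<^sub>v (D *\<^sub>v (query_mat n (Suc 0) x *\<^sub>v ?\<psi>))"
      by (intro assoc_mult_mat_vec[of _ d d _ d]) (auto simp: H_def D_def)
    moreover have "replicate k D = replicate (k - 1) D @ [D]"
      using assms(2) by (metis replicate_append_same replicate_Suc Suc_pred')
    moreover have "state_dim n A = d" "basis_index 1 0 False 0 = 0"
      by (simp_all add: valid d_def basis_index_def)
    ultimately show ?thesis
      using H_start by (simp add: final_state_def A_def)
  qed
  have D_u: "D *\<^sub>v rvec d u = rvec d u"
    using u_norm by (simp add: D_def reflection_apply power2_eq_square)
  show thesis
  proof (rule that[OF valid])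
    fix x assume unmarked: "\<And>i. i \<in> S \<Longrightarrow> \<not> x ! i"
    have "query_mat n (Suc 0) x *\<^sub>v rvec d u = rvec d u"
      unfolding d_def query_mat_rvec by (simp add: u_def grover_start_flip[OF unmarked])
    then have "foldl (step n (Suc 0) x) (rvec d u) (replicate k D) = rvec d u"
      using foldl_grover[of n x "\<lambda>_. u" "\<lambda>_. u" u k] D_u by (simp add: d_def D_def)
    then show "outcome_prob n x A 0 = 1"
      using u_norm by (simp add: outcome_prob_def final H_amp power2_eq_square del: index_mult_mat_vec)
  next
    fix j assume j: "j \<in> S"
    have "rotated \<theta> S j 0 = u"
      using s(3) by (simp add: fun_eq_iff rotated_def u_def)
    then have "foldl (step n (Suc 0) (single n j)) (rvec d u) (replicate k D) = rvec d (rotated \<theta> S j k)"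
      using foldl_grover[of n "single n j" "rotated \<theta> S j", OF rotated_step[OF j assms(3) card s(3)], of k]
      by (simp add: d_def D_def u_def)
    moreover have "(\<Sum>r<d. u r * rotated \<theta> S j k r) = cos (pi / 2)"
      using rotated_overlap[OF j assms(3) card s(3), of k] k by (simp add: u_def d_def \<theta>_def)
    ultimately show "outcome_prob n (single n j) A 0 = 0"
      by (simp add: outcome_prob_def final H_amp del: index_mult_mat_vec)
  qed
qed

section \<open>Searching block by block and the upper bound\<close>

lemma block_search_tree:
  assumes "0 < n" "0 < k"
  shows "\<exists>T. valid_hybrid_tree n T \<and> limited k T \<and> (\<forall>c \<in> path_costs T. c \<le> k * m) \<and>
    output_prob n (zeros n) T False = 1 \<and>
    (\<forall>j<n. output_prob n (single n j) T False = of_bool (m * k\<^sup>2 \<le> j))"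
proof (induction m)
  case 0
  show ?case
    by (intro exI[of _ "Leaf False"]) simp
next
  case (Suc m)
  then obtain T where T: "valid_hybrid_tree n T" "limited k T" "\<forall>c \<in> path_costs T. c \<le> k * m"
    "output_prob n (zeros n) T False = 1"
    "\<And>j. j < n \<Longrightarrow> output_prob n (single n j) T False = of_bool (m * k\<^sup>2 \<le> j)"
    by blast
  \<comment> \<open>The intersection truncates a block that reaches beyond position
    \<open>n - 1\<close>.\<close>
  define S where "S = {m * k\<^sup>2..<Suc m * k\<^sup>2} \<inter> {..<n}"
  have "card S \<le> card {m * k\<^sup>2..<Suc m * k\<^sup>2}"
    unfolding S_def by (intro card_mono) auto
  then have "S \<subseteq> {..<n}" "card S \<le> k\<^sup>2"
    by (auto simp: S_def)
  then obtain A where A: "valid_qdtree n A" "queries A = k" "state_dim n A = n * 2"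
    "\<And>x. (\<And>i. i \<in> S \<Longrightarrow> \<not> x ! i) \<Longrightarrow> outcome_prob n x A 0 = 1"
    "\<And>j. j \<in> S \<Longrightarrow> outcome_prob n (single n j) A 0 = 0"
    using block_detector[OF assms] by blast
  \<comment> \<open>Outcome 0 passes on to the blocks already handled by \<open>T\<close>; any other
    outcome answers True, and it never occurs if the block holds no one.\<close>
  define Ts where "Ts = T # replicate (n * 2 - 1) (Leaf True)"
  have len: "length Ts = Suc (n * 2 - 1)" "Suc (n * 2 - 1) = n * 2"
    using assms(1) by (auto simp: Ts_def)
  have out: "output_prob n x (Node A Ts) False = outcome_prob n x A 0 * output_prob n x T False" for x
  proof -
    have "output_prob n x (Node A Ts) False =
        (\<Sum>i<Suc (n * 2 - 1). outcome_prob n x A i * output_prob n x (Ts ! i) False)"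
      by (simp add: len)
    also have "\<dots> = outcome_prob n x A 0 * output_prob n x T False +
        (\<Sum>i<n * 2 - 1. outcome_prob n x A (Suc i) * output_prob n x (Ts ! Suc i) False)"
      by (subst sum.lessThan_Suc_shift) (simp add: Ts_def)
    also have "(\<Sum>i<n * 2 - 1. outcome_prob n x A (Suc i) * output_prob n x (Ts ! Suc i) False) = 0"
      by (intro sum.neutral) (auto simp: Ts_def)
    finally show ?thesis
      by simp
  qed
  show ?case
  proof (intro exI[of _ "Node A Ts"] conjI ballI allI impI)
    show "valid_hybrid_tree n (Node A Ts)"
      using A T(1) len by (auto simp: Ts_def)
    show "limited k (Node A Ts)"
      using A(2) T(2) by (auto simp: Ts_def)
    show "c \<le> k * Suc m" if "c \<in> path_costs (Node A Ts)" for c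
      using that A(2) T(3) by (auto simp: Ts_def split: if_splits)
    show "output_prob n (zeros n) (Node A Ts) False = 1"
      unfolding out using A(4)[of "zeros n"] T(4) by (simp add: S_def)
    show "output_prob n (single n j) (Node A Ts) False = of_bool (Suc m * k\<^sup>2 \<le> j)" if j: "j < n" for j
    proof (cases "j \<in> S")
      case True
      then show ?thesis
        unfolding out using A(5)[OF True] by (auto simp: S_def)
    next
      case False
      have "outcome_prob n (single n j) A 0 = 1"
        using False by (intro A(4)) (auto simp: single_nth S_def)
      then show ?thesis
        unfolding out using T(5)[OF j] False j by (auto simp: S_def)
    qed
  qed
qed

lemma partial_or_cases:
  assumes "partial_or n x = Some y"
  shows "x = zeros n \<and> \<not> y \<or> (\<exists>j<n. x = single n j \<and> y)"
proof -
  have len: "length x = n" and cnt: "count_list x True \<le> 1" and y: "y \<longleftrightarrow> (\<exists>i<n. x ! i)"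
    using assms by (auto simp: partial_or_def split: if_splits)
  show ?thesis
  proof (cases y)
    case False
    then show ?thesis
      using y len by (auto intro!: nth_equalityI)
  next
    case True
    then obtain j where j: "j < n" "x ! j"
      using y by blast
    have "i = j" if "i < n" "x ! i" for i
    proof (rule ccontr)
      assume "i \<noteq> j"
      have "card {i, j} \<le> card {i. i < length x \<and> x ! i = True}"
        using that j len by (intro card_mono) auto
      also have "\<dots> = count_list x True"
        by (simp add: count_list_eq_length_filter length_filter_conv_card eq_commute)
      finally show False
        using cnt \<open>i \<noteq> j\<close> by simp
    qed
    then have "x ! i = single n j ! i" if "i < n" for i
      using that j(2) single_nth[OF that, of j] by metis
    then have "x = single n j"
      using len by (intro nth_equalityI) (simp_all add: single_def)
    then show ?thesis
      using j True by blast
  qed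
qed

lemma cost_le:
  assumes "valid_hybrid_tree n T" "\<forall>c \<in> path_costs T. c \<le> b"
  shows "cost T \<le> b"
  using assms(2) path_costs_nonempty[OF assms(1)] by (simp add: cost_def finite_path_costs)

lemma search_tree_exists:
  assumes "1 \<le> q"
  obtains T where "valid_hybrid_tree n T" "limited q T" "computes n T (partial_or n)"
    "real (cost T) \<le> 3 * (real n / real q + sqrt (real n))"
proof (cases "n = 0")
  case True
  \<comment> \<open>For \<open>n = 0\<close> the state space is empty, so only leaves are valid
    trees.\<close>
  have "computes n (Leaf False) (partial_or n)"
    using partial_or_cases[of n] True by (auto simp: computes_def)
  then show thesis
    using that[of "Leaf False"] True by (simp add: cost_def)
next
  case False
  define s where "s = nat \<lceil>sqrt (real n)\<rceil>"
  define k where "k = min q s"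
  \<comment> \<open>Adding 1 makes the blocks cover all positions:
    \<open>n < m * k^2\<close>.\<close>
  define m where "m = n div k\<^sup>2 + 1"
  have n: "0 < n" "1 \<le> sqrt (real n)"
    using False by auto
  have "real s = of_int \<lceil>sqrt (real n)\<rceil>"
    by (simp add: s_def)
  \<comment> \<open>Rounding up at most doubles \<open>sqrt n\<close>, as \<open>sqrt n\<close> is
    at least 1.\<close>
  then have s: "sqrt (real n) \<le> real s" "real s \<le> 2 * sqrt (real n)"
    using n(2) ceiling_correct[of "sqrt (real n)"] by linarith+
  then have "0 < s"
    using n by (cases s) auto
  have k: "0 < k"
    using \<open>0 < s\<close> assms by (simp add: k_def)
  obtain T where T: "valid_hybrid_tree n T" "limited k T" "\<forall>c \<in> path_costs T. c \<le> k * m"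
    "output_prob n (zeros n) T False = 1"
    "\<And>j. j < n \<Longrightarrow> output_prob n (single n j) T False = of_bool (m * k\<^sup>2 \<le> j)"
    using block_search_tree[OF n(1) k] by metis
  have "limited q T"
  proof -
    have "limited k T \<Longrightarrow> limited q T"
      by (induction T) (auto simp: k_def)
    with T(2) show ?thesis
      by blast
  qed
  moreover have "computes n T (partial_or n)"
    unfolding computes_def
  proof (intro allI impI)
    fix x y assume "partial_or n x = Some y"
    then consider "x = zeros n" "y = False" | j where "j < n" "x = single n j" "y = True"
      using partial_or_cases by blast
    then show "2 / 3 \<le> output_prob n x T y"
    proof cases
      case 1
      then show ?thesis
        using T(4) by simp
    next
      case 2
      have "n < m * k\<^sup>2"
        unfolding m_def using k dividend_less_times_div[of "k\<^sup>2" n] by (simp add: algebra_simps)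
      then have "output_prob n x T False = 0"
        using T(5)[OF 2(1)] 2 by simp
      then show ?thesis
        using output_prob_add[OF T(1), of x] 2(3) by simp
    qed
  qed
  moreover have "real (cost T) \<le> 3 * (real n / real q + sqrt (real n))"
  proof -
    have "real (cost T) \<le> real (k * m)"
      using cost_le[OF T(1,3)] by (simp only: of_nat_le_iff)
    also have "\<dots> = real k * real (n div k\<^sup>2) + real k"
      by (simp add: m_def algebra_simps)
    also have "\<dots> \<le> real k * (real n / real (k\<^sup>2)) + real k"
      by (intro add_mono mult_left_mono of_nat_div_le_of_nat) auto
    also have "\<dots> = real n / real k + real k"
      using k by (simp add: power2_eq_square)
    finally have "real (cost T) \<le> real n / real k + real k" .
    moreover have "real n / real k \<le> real n / real q + sqrt (real n)"
    proof (cases "q \<le> s")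
      case True
      then show ?thesis
        by (simp add: k_def min_def)
    next
      case False
      have "real n / real s \<le> real n / sqrt (real n)"
        using s n \<open>0 < s\<close> by (intro divide_left_mono mult_pos_pos) auto
      then show ?thesis
        using False n by (simp add: k_def real_div_sqrt add_increasing)
    qed
    moreover have "real k \<le> 2 * sqrt (real n)"
      using s by (simp add: k_def)
    ultimately show ?thesis
      using divide_nonneg_nonneg[of "real n" "real q", OF of_nat_0_le_iff of_nat_0_le_iff]
      by (simp only: distrib_left)
  qed
  ultimately show thesis
    using that T(1) by blast
qed

section \<open>Both bounds for the minimal cost\<close>

theorem theorem2:
  shows "\<exists>c C :: real. 0 < c \<and> 0 < C \<and>
    (\<forall>n q :: nat. q \<ge> 1 \<longrightarrow>
       c * (real n / real q + sqrt (real n)) \<le> real (hybrid_query_complexity n q (partial_or n)) \<and>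
       real (hybrid_query_complexity n q (partial_or n)) \<le> C * (real n / real q + sqrt (real n)))"
proof (rule exI[of _ "1 / 400 :: real"], rule exI[of _ "3 :: real"], intro conjI allI impI)
  fix n q :: nat
  assume q: "1 \<le> q"
  let ?P = "\<lambda>c. \<exists>T. valid_hybrid_tree n T \<and> limited q T \<and> computes n T (partial_or n) \<and> cost T = c"
  let ?h = "hybrid_query_complexity n q (partial_or n)"
  obtain T where T: "valid_hybrid_tree n T" "limited q T" "computes n T (partial_or n)"
    "real (cost T) \<le> 3 * (real n / real q + sqrt (real n))"
    using search_tree_exists[OF q] .
  then have P: "?P (cost T)"
    by blast
  show "real ?h \<le> 3 * (real n / real q + sqrt (real n))"
    using Least_le[of ?P, OF P] T(4) by (simp add: hybrid_query_complexity_def)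
  \<comment> \<open>The tree from the upper bound shows that the \<open>LEAST\<close> is attained,
    so an optimal tree can be examined.\<close>
  obtain T' where T': "valid_hybrid_tree n T'" "limited q T'" "computes n T' (partial_or n)" "cost T' = ?h"
    using LeastI[of ?P, OF P] by (auto simp: hybrid_query_complexity_def)
  have "real n \<le> 350 * real q * real ?h"
    using limited_cost_lower_bound[OF T'(1,2,3)] T'(4) by simp
  then have "real n / real q \<le> 350 * real ?h"
    using q by (simp add: field_simps)
  \<comment> \<open>The same lower bound, now with the cost itself as the limit.\<close>
  moreover have "real n \<le> 350 * (real ?h)\<^sup>2"
    using limited_cost_lower_bound[OF T'(1) limited_cost[OF T'(1)] T'(3)] T'(4)
    by (simp add: power2_eq_square)
  \<comment> \<open>Here \<open>350 <= 19^2\<close>; the two estimates add up to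
    \<open>350 + 19 <= 400\<close>.\<close>
  then have "sqrt (real n) \<le> 19 * real ?h"
    by (intro real_le_lsqrt) (auto simp: power_mult_distrib)
  ultimately show "1 / 400 * (real n / real q + sqrt (real n)) \<le> real ?h"
    by simp
qed auto

end
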